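(* Every $\overline{S_{1,1,2}}$-free chordal graph has clique-width at most $4$.
   Context: All graphs are finite, simple and undirected. $G$ is $H$-free if it has no induced subgraph isomorphic to $H$. A graph is chordal if it contains no induced cycle $C_r$ with $r\geq 4$. $S_{1,1,2}$ (the chair) is the tree with exactly one vertex $x$ of degree 3 and exactly three leaves, at distances $1,1,2$ from $x$; $\overline{S_{1,1,2}}$ is its complement. The clique-width of a graph $G$ is the minimum number $k$ of labels needed to construct $G$ using the operations: create a single vertex with label $i$; take the disjoint union of two labelled graphs; add all edges between vertices of label $i$ and vertices of label $j$ ($i\neq j$); rename label $i$ to $j$. *)

theory Defs
  imports "Graph_Theory.Graph_Theory"
begin

text \<open>
  Finite simple undirected graphs are the \<^locale>\<open>pair_graph\<close>s of the Graph_Theory entry: finite,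
  loop-free, symmetric arc relations, the edge between \<open>u\<close> and \<open>v\<close> being the arcs \<open>(u, v)\<close> and
  \<open>(v, u)\<close>. Between such graphs \<^const>\<open>digraph_iso\<close> is ordinary graph isomorphism, as
  \<open>digraph_iso_pair_iff\<close> below confirms.
\<close>

definition induced_free :: "'b pair_pre_digraph \<Rightarrow> 'a pair_pre_digraph \<Rightarrow> bool" where
  "induced_free H G \<longleftrightarrow>
     \<not> (\<exists>K. induced_subgraph K (with_proj G) \<and> digraph_iso K (with_proj H))"

definition graph_complement :: "'a pair_pre_digraph \<Rightarrow> 'a pair_pre_digraph" where
  "graph_complement G =
     \<lparr> pverts = pverts G,
       parcs = {(u, v). u \<in> pverts G \<and> v \<in> pverts G \<and> u \<noteq> v \<and> (u, v) \<notin> parcs G} \<rparr>"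

text \<open>This is the cycle on \<open>r\<close> vertices only for \<open>r \<ge> 3\<close>.\<close>

definition cycle_graph :: "nat \<Rightarrow> nat pair_pre_digraph" where
  "cycle_graph r =
     \<lparr> pverts = {..<r},
       parcs = {(i, j). i < r \<and> j < r \<and> (j = Suc i mod r \<or> i = Suc j mod r)} \<rparr>"

definition chordal :: "'a pair_pre_digraph \<Rightarrow> bool" where
  "chordal G \<longleftrightarrow> (\<forall>r\<ge>4. induced_free (cycle_graph r) G)"

text \<open>The centre is 0; the leaves are 1 and 2 (distance 1) and 4 (distance 2, through 3).\<close>

definition chair :: "nat pair_pre_digraph" where
  "chair =
     \<lparr> pverts = {0, 1, 2, 3, 4},
       parcs = {(0, 1), (1, 0), (0, 2), (2, 0), (0, 3), (3, 0), (3, 4), (4, 3)} \<rparr>"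

text \<open>
  \<open>cw_construct k G l\<close>: the graph \<open>G\<close> with vertex labelling \<open>l\<close> can be built with the labels
  \<open>1, \<dots>, k\<close>. Values of \<open>l\<close> outside the vertex set carry no meaning. As the name of a new vertex
  is free, building \<open>G\<close> itself is no more demanding than building an isomorphic copy.
\<close>

inductive cw_construct :: "nat \<Rightarrow> 'a pair_pre_digraph \<Rightarrow> ('a \<Rightarrow> nat) \<Rightarrow> bool" for k where
  create: "i \<in> {1..k} \<Longrightarrow> cw_construct k \<lparr> pverts = {v}, parcs = {} \<rparr> (\<lambda>_. i)"
| disjoint_union:
    "\<lbrakk> cw_construct k G1 l1; cw_construct k G2 l2; pverts G1 \<inter> pverts G2 = {} \<rbrakk> \<Longrightarrow>
     cw_construct k \<lparr> pverts = pverts G1 \<union> pverts G2, parcs = parcs G1 \<union> parcs G2 \<rparr>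
       (\<lambda>v. if v \<in> pverts G1 then l1 v else l2 v)"
| join:
    "\<lbrakk> cw_construct k G l; i \<in> {1..k}; j \<in> {1..k}; i \<noteq> j \<rbrakk> \<Longrightarrow>
     cw_construct k
       \<lparr> pverts = pverts G,
         parcs = parcs G \<union> {(u, v). u \<in> pverts G \<and> v \<in> pverts G \<and>
           (l u = i \<and> l v = j \<or> l u = j \<and> l v = i)} \<rparr> l"
| relabel:
    "\<lbrakk> cw_construct k G l; i \<in> {1..k}; j \<in> {1..k} \<rbrakk> \<Longrightarrow>
     cw_construct k G (\<lambda>v. if l v = i then j else l v)"

text \<open>
  The operations never produce the graph without vertices; by convention its clique-width is 0.
  For every other \<^locale>\<open>pair_graph\<close> the minimum is taken over a nonempty set, see
  \<open>ex_cw_construct\<close> below.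
\<close>

definition clique_width :: "'a pair_pre_digraph \<Rightarrow> nat" where
  "clique_width G = (if pverts G = {} then 0 else (LEAST k. \<exists>l. cw_construct k G l))"


lemma digraph_iso_pair_iff:
  fixes G :: "'a pair_pre_digraph" and H :: "'b pair_pre_digraph"
  assumes "pair_wf_digraph G" and "pair_wf_digraph H"
  shows "digraph_iso (with_proj G) (with_proj H) \<longleftrightarrow>
    (\<exists>f. bij_betw f (pverts G) (pverts H) \<and>
       (\<forall>u\<in>pverts G. \<forall>v\<in>pverts G. (u, v) \<in> parcs G \<longleftrightarrow> (f u, f v) \<in> parcs H))"
    (is "?L \<longleftrightarrow> ?R")
proof
  interpret G: pair_wf_digraph G by fact
  assume ?L
  then obtain h where h: "pre_digraph.digraph_isomorphism (with_proj G) h"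
    and H: "with_proj H = app_iso h (with_proj G)"
    unfolding digraph_iso_def by blast
  let ?f = "iso_verts h"
  from H have V: "pverts H = ?f ` pverts G" and A: "parcs H = iso_arcs h ` parcs G"
    and "iso_tail h = fst" "iso_head h = snd"
    by (auto simp: with_proj_def app_iso_def)
  with h have inj: "inj_on ?f (pverts G)"
    and arc: "\<forall>a\<in>parcs G. iso_arcs h a = (?f (fst a), ?f (snd a))"
    by (auto simp: pre_digraph.digraph_isomorphism_def prod_eq_iff)
  have "(u, v) \<in> parcs G \<longleftrightarrow> (?f u, ?f v) \<in> parcs H" if "u \<in> pverts G" "v \<in> pverts G" for u v
  proof
    assume "(u, v) \<in> parcs G"
    with arc A show "(?f u, ?f v) \<in> parcs H" by force
  next
    assume "(?f u, ?f v) \<in> parcs H"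
    then obtain a where a: "a \<in> parcs G" "?f u = ?f (fst a)" "?f v = ?f (snd a)"
      using A arc by force
    with G.arc_fst_in_verts G.arc_snd_in_verts inj that have "u = fst a" "v = snd a"
      by (auto dest: inj_onD)
    with a show "(u, v) \<in> parcs G" by simp
  qed
  with V inj show ?R by (auto simp: bij_betw_def)
next
  interpret G: pair_wf_digraph G by fact
  interpret H: pair_wf_digraph H by fact
  assume ?R
  then obtain f where f: "bij_betw f (pverts G) (pverts H)"
    and fe: "\<And>u v. u \<in> pverts G \<Longrightarrow> v \<in> pverts G \<Longrightarrow> (u, v) \<in> parcs G \<longleftrightarrow> (f u, f v) \<in> parcs H"
    by blast
  define h where "h = \<lparr> iso_verts = f, iso_arcs = map_prod f f, iso_head = snd, iso_tail = fst \<rparr>"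
  have inj: "inj_on f (pverts G)" and V: "pverts H = f ` pverts G"
    using f by (auto simp: bij_betw_def)
  have "inj_on (map_prod f f) (parcs G)"
    by (rule inj_on_subset[OF map_prod_inj_on[OF inj inj]]) (auto dest: G.wellformed')
  then have "pre_digraph.digraph_isomorphism (with_proj G) h"
    using inj G.wf_digraph by (simp add: pre_digraph.digraph_isomorphism_def h_def)
  moreover have "parcs H = map_prod f f ` parcs G"
  proof
    show "parcs H \<subseteq> map_prod f f ` parcs G"
    proof
      fix e assume e: "e \<in> parcs H"
      then obtain u v where "u \<in> pverts G" "v \<in> pverts G" "e = (f u, f v)"
        using H.arc_fst_in_verts[OF e] H.arc_snd_in_verts[OF e] V by (cases e) auto
      with e fe show "e \<in> map_prod f f ` parcs G" by force
    qed
    show "map_prod f f ` parcs G \<subseteq> parcs H"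
      using fe by (auto dest: G.wellformed')
  qed
  ultimately show ?L
    using V unfolding digraph_iso_def
    by (intro exI[of _ h]) (auto simp: with_proj_def app_iso_def h_def)
qed

lemma pair_graph_chair: "pair_graph chair"
  by unfold_locales (auto simp: chair_def symmetric_def sym_def)

lemma pair_graph_complement:
  assumes "finite (pverts G)" and "symmetric (with_proj G)"
  shows "pair_graph (graph_complement G)"
proof -
  have "finite (parcs (graph_complement G))"
    by (rule finite_subset[of _ "pverts G \<times> pverts G"]) (auto simp: graph_complement_def assms)
  then show ?thesis
    using assms by unfold_locales (auto simp: graph_complement_def symmetric_def sym_def)
qed

lemma pair_graph_cycle_graph:
  assumes "r \<ge> 3"
  shows "pair_graph (cycle_graph r)"
proof -
  have "finite (parcs (cycle_graph r))"
    by (rule finite_subset[of _ "{..<r} \<times> {..<r}"]) (auto simp: cycle_graph_def)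
  moreover have "Suc i mod r \<noteq> i" if "i < r" for i
    using that assms by (cases "Suc i = r") auto
  ultimately show ?thesis
    by unfold_locales (fastforce simp: cycle_graph_def symmetric_def sym_def)+
qed

lemma cw_construct_edgeless:
  assumes "finite V" "V \<noteq> {}" "\<forall>v\<in>V. f v \<in> {1..k}"
  shows "\<exists>l. cw_construct k \<lparr> pverts = V, parcs = {} \<rparr> l \<and> (\<forall>v\<in>V. l v = f v)"
  using assms
proof (induction V rule: finite_ne_induct)
  case (singleton x)
  then show ?case using create[of "f x" k x] by (intro exI[of _ "\<lambda>_. f x"]) simp
next
  case (insert x F)
  then obtain l where l: "cw_construct k \<lparr> pverts = F, parcs = {} \<rparr> l" "\<forall>v\<in>F. l v = f v"
    by auto
  have "cw_construct k \<lparr> pverts = {x}, parcs = {} \<rparr> (\<lambda>_. f x)"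
    using insert.prems by (intro create) simp
  from disjoint_union[OF this l(1)] insert.hyps l(2) show ?case
    by (intro exI[of _ "\<lambda>v. if v \<in> {x} then f x else l v"]) auto
qed

lemma ex_cw_construct:
  assumes "pair_graph G" and "pverts G \<noteq> {}"
  shows "\<exists>k l. cw_construct k G l"
proof -
  interpret pair_graph G by fact
  let ?k = "card (pverts G)"
  obtain f where f: "bij_betw f (pverts G) {1..?k}"
    using pair_finite_verts
    by (metis finite_same_card_bij card_atLeastAtMost diff_Suc_1 finite_atLeastAtMost)
  then have fr: "\<forall>v\<in>pverts G. f v \<in> {1..?k}" and fi: "inj_on f (pverts G)"
    by (auto simp: bij_betw_def)
  obtain l where l: "cw_construct ?k \<lparr> pverts = pverts G, parcs = {} \<rparr> l"
    and lf: "\<forall>v\<in>pverts G. l v = f v"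
    using cw_construct_edgeless[OF pair_finite_verts assms(2) fr] by auto
  have "cw_construct ?k \<lparr> pverts = pverts G, parcs = F \<union> F\<inverse> \<rparr> l"
    if "finite F" "F \<subseteq> parcs G" for F
    using that
  proof (induction F rule: finite_induct)
    case empty
    then show ?case using l by simp
  next
    case (insert e F)
    obtain a b where e: "e = (a, b)" by (cases e)
    with insert.prems have ab: "a \<in> pverts G" "b \<in> pverts G" "a \<noteq> b"
      by (auto dest: wellformed' no_loops')
    have iff: "l u = l w \<longleftrightarrow> u = w" if "u \<in> pverts G" "w \<in> pverts G" for u w
      using that lf fi by (auto dest: inj_onD)
    have IH: "cw_construct ?k \<lparr> pverts = pverts G, parcs = F \<union> F\<inverse> \<rparr> l"
      using insert by simp
    have "cw_construct ?k \<lparr> pverts = pverts G, parcs = (F \<union> F\<inverse>) \<union>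
       {(u, v). u \<in> pverts G \<and> v \<in> pverts G \<and> (l u = l a \<and> l v = l b \<or> l u = l b \<and> l v = l a)} \<rparr> l"
      using join[OF IH, of "l a" "l b"] lf fr ab iff by simp
    moreover have "{(u, v). u \<in> pverts G \<and> v \<in> pverts G \<and>
        (l u = l a \<and> l v = l b \<or> l u = l b \<and> l v = l a)} = {(a, b), (b, a)}"
      using ab iff by auto
    moreover have "(F \<union> F\<inverse>) \<union> {(a, b), (b, a)} = insert e F \<union> (insert e F)\<inverse>"
      using e by auto
    ultimately show ?case by simp
  qed
  from this[OF pair_finite_arcs] have
    "cw_construct ?k \<lparr> pverts = pverts G, parcs = parcs G \<union> (parcs G)\<inverse> \<rparr> l"
    by simp
  moreover have "parcs G \<union> (parcs G)\<inverse> = parcs G"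
    by (auto intro: arcs_symmetric)
  ultimately have "cw_construct ?k G l" by (cases G) simp
  then show ?thesis by blast
qed

end

theory Submission
  imports Defs
begin

text \<open>
  The complement of the chair is the kite: two adjacent vertices \<open>a\<close>, \<open>b\<close>, both adjacent to the
  nonadjacent \<open>c\<close>, \<open>d\<close>, and a pendant vertex \<open>e\<close> at \<open>c\<close>.

  Substituting a graph for a vertex does not raise the clique-width, so it suffices to treat prime
  graphs, those without nontrivial modules. A chordal graph without induced diamonds is a block
  graph; it is built with three labels by recursion over rooted connected pieces. If a prime kite-free
  chordal graph contains a diamond, choose nonadjacent \<open>c\<close>, \<open>d\<close> with as many common neighbours as
  possible and let \<open>L\<close> be \<open>c\<close> together with these. Then \<open>L\<close> is a clique, and primality forces each
  \<open>i \<in> L\<close> to have a partner, a vertex whose neighbours in \<open>L\<close> are all but \<open>i\<close>. The graph is a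
  thick spider, possibly with one further vertex adjacent to exactly \<open>L\<close>, and four labels suffice:
  two for the finished part, two for the next vertex of \<open>L\<close> and its partner.
\<close>

section \<open>Labelled constructions\<close>

definition induced_graph :: "('a \<Rightarrow> 'a \<Rightarrow> bool) \<Rightarrow> 'a set \<Rightarrow> 'a pair_pre_digraph" where
  "induced_graph E V = \<lparr> pverts = V, parcs = {(u, v). u \<in> V \<and> v \<in> V \<and> E u v} \<rparr>"

lemma pverts_induced_graph [simp]: "pverts (induced_graph E V) = V"
  by (simp add: induced_graph_def)

lemma parcs_induced_graph [simp]:
  "parcs (induced_graph E V) = {(u, v). u \<in> V \<and> v \<in> V \<and> E u v}"
  by (simp add: induced_graph_def)

lemma induced_graph_cong:
  "V = W \<Longrightarrow> (\<And>u v. u \<in> W \<Longrightarrow> v \<in> W \<Longrightarrow> E u v \<longleftrightarrow> F u v) \<Longrightarrow> induced_graph E V = induced_graph F W"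
  by (auto simp: induced_graph_def)

text \<open>Labels are prescribed on \<open>V\<close> only, as other values carry no meaning. With
  \<open>E\<close> fixed, induced subgraphs differ just in \<open>V\<close>.\<close>

definition constructible :: "nat \<Rightarrow> ('a \<Rightarrow> 'a \<Rightarrow> bool) \<Rightarrow> 'a set \<Rightarrow> ('a \<Rightarrow> nat) \<Rightarrow> bool" where
  "constructible k E V f \<longleftrightarrow> (\<exists>l. cw_construct k (induced_graph E V) l \<and> (\<forall>v\<in>V. l v = f v))"

lemma constructible_cong:
  assumes "constructible k E V f" "V = W"
    and "\<And>u v. u \<in> W \<Longrightarrow> v \<in> W \<Longrightarrow> E u v \<longleftrightarrow> F u v" "\<And>v. v \<in> W \<Longrightarrow> f v = g v"
  shows "constructible k F W g"
  using assms(1,2,4) induced_graph_cong[OF assms(2,3)] by (auto simp: constructible_def)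

lemma constructible_singleton:
  assumes "f v \<in> {1..k}" "\<not> E v v"
  shows "constructible k E {v} f"
proof -
  have "induced_graph E {v} = \<lparr> pverts = {v}, parcs = {} \<rparr>"
    using assms(2) by (auto simp: induced_graph_def)
  then show ?thesis
    unfolding constructible_def using create[OF assms(1), of v] by auto
qed

lemma constructible_disjoint_union:
  assumes "constructible k E V f" "constructible k E W g" "V \<inter> W = {}"
    and "\<And>u v. u \<in> V \<Longrightarrow> v \<in> W \<Longrightarrow> \<not> E u v \<and> \<not> E v u"
  shows "constructible k E (V \<union> W) (\<lambda>v. if v \<in> V then f v else g v)"
proof -
  obtain l m where l: "cw_construct k (induced_graph E V) l" "\<forall>v\<in>V. l v = f v"
    and m: "cw_construct k (induced_graph E W) m" "\<forall>v\<in>W. m v = g v"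
    using assms(1,2) by (auto simp: constructible_def)
  have "\<lparr> pverts = V \<union> W, parcs = parcs (induced_graph E V) \<union> parcs (induced_graph E W) \<rparr> =
      induced_graph E (V \<union> W)"
    using assms(4) by (auto simp: induced_graph_def)
  then show ?thesis
    using disjoint_union[OF l(1) m(1)] assms(3) l(2) m(2) unfolding constructible_def by fastforce
qed

lemma constructible_join:
  assumes "constructible k E V f" "i \<in> {1..k}" "j \<in> {1..k}" "i \<noteq> j"
  shows "constructible k (\<lambda>u v. E u v \<or> f u = i \<and> f v = j \<or> f u = j \<and> f v = i) V f"
proof -
  obtain l where l: "cw_construct k (induced_graph E V) l" "\<forall>v\<in>V. l v = f v"
    using assms(1) by (auto simp: constructible_def)
  have "induced_graph (\<lambda>u v. E u v \<or> f u = i \<and> f v = j \<or> f u = j \<and> f v = i) V =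
      \<lparr> pverts = V, parcs = parcs (induced_graph E V) \<union>
        {(u, v). u \<in> V \<and> v \<in> V \<and> (l u = i \<and> l v = j \<or> l u = j \<and> l v = i)} \<rparr>"
    using l(2) by (auto simp: induced_graph_def)
  with join[OF l(1) assms(2-4)] l(2) show ?thesis
    unfolding constructible_def by auto
qed

lemma constructible_relabel:
  assumes "constructible k E V f" "i \<in> {1..k}" "j \<in> {1..k}"
  shows "constructible k E V (\<lambda>v. if f v = i then j else f v)"
proof -
  obtain l where l: "cw_construct k (induced_graph E V) l" "\<forall>v\<in>V. l v = f v"
    using assms(1) by (auto simp: constructible_def)
  from relabel[OF l(1) assms(2,3)] l(2) show ?thesis
    unfolding constructible_def by (intro exI conjI) auto
qed

lemma constructible_joins:
  assumes "finite J" "constructible k E V f"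
    and "\<And>i j. (i, j) \<in> J \<Longrightarrow> i \<in> {1..k} \<and> j \<in> {1..k} \<and> i \<noteq> j"
  shows "constructible k (\<lambda>u v. E u v \<or> (f u, f v) \<in> J \<or> (f v, f u) \<in> J) V f"
  using assms(1,3)
proof (induction J rule: finite_induct)
  case empty
  then show ?case using assms(2) by simp
next
  case (insert e J)
  obtain i j where e: "e = (i, j)" by (cases e)
  have "constructible k (\<lambda>u v. E u v \<or> (f u, f v) \<in> J \<or> (f v, f u) \<in> J) V f"
    using insert by blast
  moreover have "i \<in> {1..k}" "j \<in> {1..k}" "i \<noteq> j"
    using insert.prems[of i j] e by auto
  ultimately show ?case
    by (rule constructible_cong[OF constructible_join]) (auto simp: e)
qed

text \<open>A join acts on the whole graph. As \<open>j\<close> is no label on \<open>V\<close> and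
  \<open>i\<close> none on \<open>W\<close>, a label pair in \<open>J\<close> can only be met by a
  vertex of \<open>V\<close> and a vertex of \<open>W\<close>, so nothing is added within either
  side.\<close>

lemma constructible_union_join:
  assumes V: "constructible k E V f" and W: "constructible k E W g" and disj: "V \<inter> W = {}"
    and J: "finite J"
      "\<And>i j. (i, j) \<in> J \<Longrightarrow> i \<in> {1..k} \<and> j \<in> {1..k} \<and> i \<noteq> j \<and> j \<notin> f ` V \<and> i \<notin> g ` W"
    and E: "\<And>u v. u \<in> V \<Longrightarrow> v \<in> W \<Longrightarrow> (E u v \<longleftrightarrow> (f u, g v) \<in> J) \<and> (E v u \<longleftrightarrow> (f u, g v) \<in> J)"
  shows "constructible k E (V \<union> W) (\<lambda>v. if v \<in> V then f v else g v)"
proof -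
  let ?h = "\<lambda>v. if v \<in> V then f v else g v"
  \<comment> \<open>\<open>F\<close> lacks the edges between \<open>V\<close> and \<open>W\<close>,
    which the joins then supply.\<close>
  define F where "F u v \<longleftrightarrow> E u v \<and> (u \<in> V \<longleftrightarrow> v \<in> V)" for u v
  have "constructible k F V f" "constructible k F W g"
    by (rule constructible_cong[OF V]; use disj in \<open>auto simp: F_def\<close>)
      (rule constructible_cong[OF W]; use disj in \<open>auto simp: F_def\<close>)
  then have "constructible k F (V \<union> W) ?h"
    using disj by (intro constructible_disjoint_union) (auto simp: F_def)
  from constructible_joins[OF J(1) this] J(2)
  have "constructible k (\<lambda>u v. F u v \<or> (?h u, ?h v) \<in> J \<or> (?h v, ?h u) \<in> J) (V \<union> W) ?h"
    by blast
  then show ?thesis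
  proof (rule constructible_cong)
    fix u v assume uv: "u \<in> V \<union> W" "v \<in> V \<union> W"
    show "F u v \<or> (?h u, ?h v) \<in> J \<or> (?h v, ?h u) \<in> J \<longleftrightarrow> E u v"
    proof (cases "u \<in> V"; cases "v \<in> V")
      assume "u \<in> V" "v \<in> V"
      then show ?thesis using J(2) by (auto simp: F_def)
    next
      assume "u \<notin> V" "v \<notin> V"
      with uv have "u \<in> W" "v \<in> W" by auto
      with \<open>u \<notin> V\<close> \<open>v \<notin> V\<close> show ?thesis using J(2) by (auto simp: F_def)
    next
      assume a: "u \<in> V" "v \<notin> V"
      with uv have "v \<in> W" by auto
      with a J(2) E[of u v] show ?thesis by (auto simp: F_def)
    next
      assume a: "u \<notin> V" "v \<in> V"
      with uv have "u \<in> W" by auto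
      with a J(2) E[of v u] show ?thesis by (auto simp: F_def)
    qed
  qed auto
qed

section \<open>Substitution and modules\<close>

lemma cw_construct_label_range:
  "cw_construct k G l \<Longrightarrow> v \<in> pverts G \<Longrightarrow> l v \<in> {1..k}"
  by (induction rule: cw_construct.induct) auto

lemma cw_construct_arcs:
  "cw_construct k G l \<Longrightarrow> (u, v) \<in> parcs G \<Longrightarrow>
    u \<in> pverts G \<and> v \<in> pverts G \<and> u \<noteq> v \<and> (v, u) \<in> parcs G"
  by (induction rule: cw_construct.induct) auto

lemma cw_construct_constant_label:
  assumes "cw_construct k G l" "i \<in> {1..k}"
  shows "\<exists>l'. cw_construct k G l' \<and> (\<forall>v\<in>pverts G. l' v = i)"
proof -
  \<comment> \<open>Labels are renamed to \<open>i\<close> one at a time; after \<open>n\<close>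
    rounds no label up to \<open>n\<close> is left except possibly \<open>i\<close>.\<close>
  have "\<exists>l'. cw_construct k G l' \<and> (\<forall>v\<in>pverts G. l' v = i \<or> l' v > n)" if "n \<le> k" for n
    using that
  proof (induction n)
    case 0
    then show ?case using assms cw_construct_label_range[OF assms(1)] by fastforce
  next
    case (Suc n)
    then obtain l' where l': "cw_construct k G l'" "\<forall>v\<in>pverts G. l' v = i \<or> l' v > n"
      by auto
    have "Suc n \<in> {1..k}" using Suc by auto
    moreover have "\<forall>v\<in>pverts G. (if l' v = Suc n then i else l' v) = i \<or>
        (if l' v = Suc n then i else l' v) > Suc n"
      using l'(2) by (auto dest: Suc_lessI)
    ultimately show ?case
      using relabel[OF l'(1) _ assms(2)] by blast
  qed
  from this[of k] show ?thesis
    using cw_construct_label_range by (metis atLeastAtMost_iff le_refl not_le)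
qed

text \<open>\<open>H\<close> may contain \<open>m\<close> itself, just as a module contains its
  representative.\<close>

definition substitute :: "'a pair_pre_digraph \<Rightarrow> 'a \<Rightarrow> 'a pair_pre_digraph \<Rightarrow> 'a pair_pre_digraph"
where
  "substitute G m H =
     \<lparr> pverts = (pverts G - {m}) \<union> pverts H,
       parcs = {(u, v) \<in> parcs G. u \<noteq> m \<and> v \<noteq> m} \<union> parcs H \<union>
         {(u, v). u \<in> pverts H \<and> (m, v) \<in> parcs G} \<union> {(u, v). v \<in> pverts H \<and> (u, m) \<in> parcs G} \<rparr>"

text \<open>Follow the construction of \<open>G\<close>, but where \<open>m\<close> is created,
  build \<open>H\<close> and rename all its labels to that of \<open>m\<close>. From then on
  \<open>H\<close> carries the current label of \<open>m\<close> throughout, so later operations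
  treat its vertices as they treat \<open>m\<close>.\<close>

lemma cw_construct_substitute:
  assumes "cw_construct k G l" "cw_construct k H h" "m \<in> pverts G" "pverts H \<inter> pverts G \<subseteq> {m}"
  shows "\<exists>l'. cw_construct k (substitute G m H) l' \<and>
    (\<forall>v\<in>pverts G - {m} - pverts H. l' v = l v) \<and> (\<forall>v\<in>pverts H. l' v = l m)"
  using assms(1,3,4)
proof (induction rule: cw_construct.induct)
  case (create i v)
  then have "substitute \<lparr> pverts = {v}, parcs = {} \<rparr> m H = H"
    by (auto simp: substitute_def)
  with cw_construct_constant_label[OF assms(2) create(1)] create(2) show ?case by auto
next
  case (disjoint_union G1 l1 G2 l2)
  let ?G = "\<lparr> pverts = pverts G1 \<union> pverts G2, parcs = parcs G1 \<union> parcs G2 \<rparr>"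
  note A1 = cw_construct_arcs[OF disjoint_union.hyps(1)]
  note A2 = cw_construct_arcs[OF disjoint_union.hyps(2)]
  have disj: "pverts G1 \<inter> pverts G2 = {}" by fact
  show ?case
  proof (cases "m \<in> pverts G1")
    case True
    then obtain l' where l': "cw_construct k (substitute G1 m H) l'"
      "\<forall>v\<in>pverts G1 - {m} - pverts H. l' v = l1 v" "\<forall>v\<in>pverts H. l' v = l1 m"
      using disjoint_union.IH disjoint_union.prems by fastforce
    have 1: "pverts (substitute G1 m H) \<inter> pverts G2 = {}"
      using disjoint_union.prems disj True by (auto simp: substitute_def)
    have "parcs (substitute G1 m H) \<union> parcs G2 = parcs (substitute ?G m H)"
      using True disj by (auto simp: substitute_def dest: A2)
    moreover have "pverts (substitute G1 m H) \<union> pverts G2 = pverts (substitute ?G m H)"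
      using True disj by (auto simp: substitute_def)
    ultimately have 2: "\<lparr> pverts = pverts (substitute G1 m H) \<union> pverts G2,
      parcs = parcs (substitute G1 m H) \<union> parcs G2 \<rparr> = substitute ?G m H"
      by (simp add: pair_pre_digraph.equality)
    note 3 = cw_construct.disjoint_union[OF l'(1) disjoint_union.hyps(2) 1]
    show ?thesis
      by (rule exI, rule conjI, rule 3[unfolded 2])
        (use True l'(2,3) disj disjoint_union.prems in \<open>auto simp: substitute_def\<close>)
  next
    case False
    then obtain l' where l': "cw_construct k (substitute G2 m H) l'"
      "\<forall>v\<in>pverts G2 - {m} - pverts H. l' v = l2 v" "\<forall>v\<in>pverts H. l' v = l2 m"
      using disjoint_union.IH disjoint_union.prems by fastforce
    have 1: "pverts G1 \<inter> pverts (substitute G2 m H) = {}"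
      using disjoint_union.prems disj False by (auto simp: substitute_def)
    have "parcs G1 \<union> parcs (substitute G2 m H) = parcs (substitute ?G m H)"
      using False disj by (auto simp: substitute_def dest: A1)
    moreover have "pverts G1 \<union> pverts (substitute G2 m H) = pverts (substitute ?G m H)"
      using False disj by (auto simp: substitute_def)
    ultimately have 2: "\<lparr> pverts = pverts G1 \<union> pverts (substitute G2 m H),
      parcs = parcs G1 \<union> parcs (substitute G2 m H) \<rparr> = substitute ?G m H"
      by (simp add: pair_pre_digraph.equality)
    note 3 = cw_construct.disjoint_union[OF disjoint_union.hyps(1) l'(1) 1]
    show ?thesis
      by (rule exI, rule conjI, rule 3[unfolded 2])
        (use False l'(2,3) disj disjoint_union.prems in \<open>auto simp: substitute_def\<close>)
  qed
next
  case (join G l i j)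
  let ?G = "\<lparr> pverts = pverts G, parcs = parcs G \<union> {(u, v). u \<in> pverts G \<and> v \<in> pverts G \<and>
           (l u = i \<and> l v = j \<or> l u = j \<and> l v = i)} \<rparr>"
  obtain l' where l': "cw_construct k (substitute G m H) l'"
      "\<forall>v\<in>pverts G - {m} - pverts H. l' v = l v" "\<forall>v\<in>pverts H. l' v = l m"
    using join by auto
  have L: "l' v = l m" if "v \<in> pverts H" for v
    using l'(3) that by simp
  have L': "l' v = l v" if "v \<in> pverts G" "v \<noteq> m" "v \<notin> pverts H" for v
    using l'(2) that by simp
  have arcs: "(u, v) \<in> parcs (substitute G m H) \<union>
      {(u, v). u \<in> pverts (substitute G m H) \<and> v \<in> pverts (substitute G m H) \<and>
        (l' u = i \<and> l' v = j \<or> l' u = j \<and> l' v = i)} \<longleftrightarrow> (u, v) \<in> parcs (substitute ?G m H)"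
    for u v
  proof (cases "u \<in> pverts H"; cases "v \<in> pverts H")
    \<comment> \<open>Both ends carry the label of \<open>m\<close>, while a join needs two distinct
      labels; nothing is added inside \<open>H\<close>.\<close>
    assume "u \<in> pverts H" "v \<in> pverts H"
    then show ?thesis
      using join.hyps(4) join.prems by (auto simp: substitute_def L)
  next
    assume uv: "u \<in> pverts H" "v \<notin> pverts H"
    show ?thesis
    proof (cases "v \<in> pverts G \<and> v \<noteq> m")
      case True
      with uv join.hyps(4) join.prems show ?thesis by (auto simp: substitute_def L L')
    qed (use uv join.hyps(4) join.prems in \<open>auto simp: substitute_def\<close>)
  next
    assume uv: "u \<notin> pverts H" "v \<in> pverts H"
    show ?thesis
    proof (cases "u \<in> pverts G \<and> u \<noteq> m")
      case True
      with uv join.hyps(4) join.prems show ?thesis by (auto simp: substitute_def L L')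
    qed (use uv join.hyps(4) join.prems in \<open>auto simp: substitute_def\<close>)
  next
    assume uv: "u \<notin> pverts H" "v \<notin> pverts H"
    show ?thesis
    proof (cases "u \<in> pverts G \<and> u \<noteq> m \<and> v \<in> pverts G \<and> v \<noteq> m")
      case True
      with uv show ?thesis by (auto simp: substitute_def L')
    qed (use uv in \<open>auto simp: substitute_def\<close>)
  qed
  have "parcs (substitute G m H) \<union>
      {(u, v). u \<in> pverts (substitute G m H) \<and> v \<in> pverts (substitute G m H) \<and>
        (l' u = i \<and> l' v = j \<or> l' u = j \<and> l' v = i)} = parcs (substitute ?G m H)"
    by (rule set_eqI) (use arcs[of "fst e" "snd e" for e] in \<open>unfold prod.collapse\<close>)
  then have eq: "\<lparr> pverts = pverts (substitute G m H), parcs = parcs (substitute G m H) \<union>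
      {(u, v). u \<in> pverts (substitute G m H) \<and> v \<in> pverts (substitute G m H) \<and>
        (l' u = i \<and> l' v = j \<or> l' u = j \<and> l' v = i)} \<rparr> = substitute ?G m H"
    by (simp add: substitute_def)
  from cw_construct.join[OF l'(1) join.hyps(2-4)] l'(2,3) show ?case
    unfolding eq by auto
next
  case (relabel G l i j)
  then obtain l' where l': "cw_construct k (substitute G m H) l'"
      "\<forall>v\<in>pverts G - {m} - pverts H. l' v = l v" "\<forall>v\<in>pverts H. l' v = l m"
    by auto
  from cw_construct.relabel[OF l'(1) relabel.hyps(2,3)] l'(2,3) show ?case
    by (intro exI conjI) auto
qed

text \<open>Swapping \<open>u\<close> and \<open>v\<close> makes the implication an equivalence: a
  vertex outside \<open>M\<close> sees all of \<open>M\<close> or none of it.\<close>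

definition graph_module :: "('a \<Rightarrow> 'a \<Rightarrow> bool) \<Rightarrow> 'a set \<Rightarrow> 'a set \<Rightarrow> bool" where
  "graph_module E V M \<longleftrightarrow> M \<subseteq> V \<and> (\<forall>x\<in>V - M. \<forall>u\<in>M. \<forall>v\<in>M. E x u \<longrightarrow> E x v)"

text \<open>The graph on \<open>V\<close> arises from the quotient, in which \<open>m\<close> stands
  for \<open>M\<close>, by substituting the graph on \<open>M\<close> for \<open>m\<close>.\<close>

lemma constructible_module:
  assumes sym: "\<And>u v. E u v \<Longrightarrow> E v u" and irrefl: "\<And>v. \<not> E v v"
    and M: "graph_module E V M" "m \<in> M"
    and "constructible k E M f" "constructible k E (insert m (V - M)) g"
  shows "\<exists>f. constructible k E V f"
proof -
  obtain h l where "cw_construct k (induced_graph E M) h"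
    and "cw_construct k (induced_graph E (insert m (V - M))) l"
    using assms(5,6) by (auto simp: constructible_def)
  from cw_construct_substitute[OF this(2,1), of m]
  obtain l' where "cw_construct k
      (substitute (induced_graph E (insert m (V - M))) m (induced_graph E M)) l'"
    using M by auto
  moreover have "substitute (induced_graph E (insert m (V - M))) m (induced_graph E M) =
      induced_graph E V"
    using M by (auto simp: substitute_def induced_graph_def graph_module_def irrefl) (metis sym DiffI)+
  ultimately show ?thesis
    by (auto simp: constructible_def)
qed

section \<open>Prime kite-free chordal graphs with a diamond\<close>

locale simple_graph =
  fixes E :: "'a \<Rightarrow> 'a \<Rightarrow> bool" and V :: "'a set"
  assumes finite_V: "finite V"
    and adj_sym: "E u v \<Longrightarrow> E v u"
    and adj_irrefl: "\<not> E v v"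
begin

definition common_nbrs :: "'a \<Rightarrow> 'a \<Rightarrow> 'a set" where
  "common_nbrs c d = {v \<in> V. E v c \<and> E v d}"

definition clique :: "'a set \<Rightarrow> bool" where
  "clique L \<longleftrightarrow> (\<forall>a\<in>L. \<forall>b\<in>L. a \<noteq> b \<longrightarrow> E a b)"

definition partner :: "'a set \<Rightarrow> 'a \<Rightarrow> 'a \<Rightarrow> bool" where
  "partner L i p \<longleftrightarrow> i \<in> L \<and> p \<in> V - L \<and> (\<forall>j\<in>L. E p j \<longleftrightarrow> j \<noteq> i)"

definition prime :: bool where
  "prime \<longleftrightarrow> (\<forall>M. graph_module E V M \<longrightarrow> card M \<le> 1 \<or> M = V)"

text \<open>Primality is exploited through this rule: one names a candidate module, and the vertex
  \<open>x\<close> that splits it drives the argument.\<close>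

lemma prime_moduleE:
  assumes prime "M \<subseteq> V" "a \<in> M" "b \<in> M" "a \<noteq> b" "z \<in> V - M"
  obtains x u v where "x \<in> V - M" "u \<in> M" "v \<in> M" "E x u" "\<not> E x v"
proof -
  have "finite M" using assms(2) finite_V by (rule finite_subset)
  then have "card M > 1"
    using card_mono[of M "{a, b}"] assms(3-5) by auto
  then have "\<not> graph_module E V M"
    using assms(1,6) by (auto simp: prime_def)
  with assms(2) that show thesis
    by (auto simp: graph_module_def)
qed

end

locale chordal_graph = simple_graph +
  assumes no_induced_cycle:
    "\<lbrakk> 4 \<le> r; inj_on f {..<r}; f ` {..<r} \<subseteq> V;
       \<And>i j. \<lbrakk> i < r; j < r \<rbrakk> \<Longrightarrow> E (f i) (f j) \<longleftrightarrow> j = Suc i mod r \<or> i = Suc j mod r \<rbrakk> \<Longrightarrow> False"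
begin

lemma C4_free:
  assumes "{a, b, c, d} \<subseteq> V" "E a b" "E b c" "E c d" "E d a" "a \<noteq> c" "b \<noteq> d"
  shows "E a c \<or> E b d"
proof (rule ccontr)
  assume "\<not> (E a c \<or> E b d)"
  then have non: "\<not> E a c" "\<not> E c a" "\<not> E b d" "\<not> E d b"
    by (auto dest: adj_sym)
  have adj: "E b a" "E c b" "E d c" "E a d"
    using assms by (auto intro: adj_sym)
  have dist: "distinct [a, b, c, d]"
    using assms adj_irrefl by auto
  have "{..<4::nat} = {0, 1, 2, 3}" by auto
  then have "inj_on ((!) [a, b, c, d]) {..<4}" "(!) [a, b, c, d] ` {..<4} \<subseteq> V"
    using assms(1) dist by (auto simp: inj_on_def)
  then show False
  proof (rule no_induced_cycle[rotated])
    fix i j :: nat assume "i < 4" "j < 4"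
    then have ij: "i = 0 \<or> i = 1 \<or> i = 2 \<or> i = 3" "j = 0 \<or> j = 1 \<or> j = 2 \<or> j = 3" by auto
    show "E ([a, b, c, d] ! i) ([a, b, c, d] ! j) \<longleftrightarrow> j = Suc i mod 4 \<or> i = Suc j mod 4"
      by (rule disjE[OF ij(1)]; (elim disjE)?; rule disjE[OF ij(2)]; (elim disjE)?;
          simp add: assms(2-5) adj non adj_irrefl)
  qed simp
qed

end

locale kite_free_chordal_graph = chordal_graph +
  assumes kite_free:
    "\<lbrakk> {a, b, c, d, e} \<subseteq> V; E a b; E a c; E a d; E b c; E b d; E c e; c \<noteq> d; \<not> E c d \<rbrakk> \<Longrightarrow>
      E a e \<or> E b e \<or> E d e"
begin

text \<open>Two common neighbours \<open>a\<close>, \<open>b\<close> give the 4-cycle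
  \<open>a\<close>, \<open>c\<close>, \<open>b\<close>, \<open>d\<close>, whose only possible chord
  is \<open>E a b\<close>.\<close>

lemma clique_common_nbrs:
  assumes "c \<in> V" "d \<in> V" "c \<noteq> d" "\<not> E c d"
  shows "clique (common_nbrs c d)"
  unfolding clique_def common_nbrs_def
proof (intro ballI impI)
  fix a b assume "a \<in> {v \<in> V. E v c \<and> E v d}" "b \<in> {v \<in> V. E v c \<and> E v d}" "a \<noteq> b"
  with C4_free[of a c b d] assms show "E a b"
    by (auto intro: adj_sym)
qed

end

section \<open>A clique of extremal size and its partners\<close>

locale max_common_nbrs = kite_free_chordal_graph +
  fixes q :: nat
  assumes card_common_nbrs:
    "\<lbrakk> c \<in> V; d \<in> V; c \<noteq> d; \<not> E c d \<rbrakk> \<Longrightarrow> card (common_nbrs c d) \<le> q"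
    and q_ge_2: "q \<ge> 2"
    and prime: prime
begin

lemma finite_common_nbrs [simp]: "finite (common_nbrs c d)"
  by (simp add: common_nbrs_def finite_V)

text \<open>The set \<open>W\<close> of vertices complete to \<open>Q\<close> contains
  \<open>c\<close> and \<open>d\<close> but no vertex of \<open>Q\<close>, so some \<open>y\<close>
  outside splits it. It remains to find a nonadjacent pair in \<open>W\<close> that \<open>y\<close>
  splits; by maximality of \<open>q\<close> its common neighbours are again exactly
  \<open>Q\<close>.\<close>

lemma common_nbrs_distinguisher:
  assumes "c \<in> V" "d \<in> V" "c \<noteq> d" "\<not> E c d" "common_nbrs c d = Q" "card Q = q"
  obtains w w' y where "w \<in> V" "w' \<in> V" "w \<noteq> w'" "\<not> E w w'" "common_nbrs w w' = Q"
    "y \<in> V" "E y w" "\<not> E y w'" "\<exists>t\<in>Q. y \<noteq> t \<and> \<not> E y t"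
proof -
  define W where "W = {w \<in> V. \<forall>t\<in>Q. E w t}"
  have Q: "Q = {v \<in> V. E v c \<and> E v d}"
    using assms(5) by (simp add: common_nbrs_def)
  have W: "W \<subseteq> V" "c \<in> W" "d \<in> W"
    using assms Q by (auto simp: W_def intro: adj_sym)
  obtain t where "t \<in> Q" using assms(6) q_ge_2 by fastforce
  then have "t \<in> V - W" using Q by (auto simp: W_def adj_irrefl)
  from prime_moduleE[OF prime W assms(3) this]
  obtain y u v where y: "y \<in> V - W" "u \<in> W" "v \<in> W" "E y u" "\<not> E y v" .
  from y(3,5) have "y \<notin> Q" by (auto simp: W_def intro: adj_sym)
  then have yn: "\<not> (E y c \<and> E y d)" using Q y by auto
  have cn: "common_nbrs w w' = Q" if "w \<in> W" "w' \<in> W" "w \<noteq> w'" "\<not> E w w'" for w w'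
  proof -
    have "Q \<subseteq> common_nbrs w w'"
      using that Q by (auto simp: W_def common_nbrs_def intro: adj_sym)
    then show ?thesis
      using card_common_nbrs[of w w'] that assms(6) card_seteq[of "common_nbrs w w'" Q]
      by (auto simp: W_def)
  qed
  have ex: "\<exists>t\<in>Q. y \<noteq> t \<and> \<not> E y t"
    using y(1) \<open>y \<notin> Q\<close> by (auto simp: W_def)
  have "\<exists>w\<in>W. \<exists>w'\<in>W. w \<noteq> w' \<and> \<not> E w w' \<and> E y w \<and> \<not> E y w'"
  \<comment> \<open>\<open>y\<close> does not see both \<open>c\<close> and \<open>d\<close>. If it
    sees one, it splits this pair. If it sees neither, it splits \<open>u\<close> from whichever of
    \<open>c\<close>, \<open>d\<close> is not adjacent to \<open>u\<close>.\<close>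
  proof (cases "E y c \<or> E y d")
    case True
    moreover have "\<not> E d c" using assms(4) adj_sym by blast
    ultimately show ?thesis using yn W(2,3) assms(3,4) by metis
  next
    case False
    with y(4) have "u \<noteq> c" "u \<noteq> d" by auto
    have "u \<notin> Q" using y(2) adj_irrefl by (auto simp: W_def)
    then have "\<not> E u c \<or> \<not> E u d" using Q y(2) by (auto simp: W_def)
    then show ?thesis
      using False W y \<open>u \<noteq> c\<close> \<open>u \<noteq> d\<close> by blast
  qed
  then obtain w w' where ww: "w \<in> W" "w' \<in> W" "w \<noteq> w'" "\<not> E w w'" "E y w" "\<not> E y w'"
    by blast
  show thesis
    by (rule that[of w w' y]) (use ww cn[OF ww(1-4)] y ex W in auto)
qed

text \<open>Let \<open>L\<close> be \<open>w\<close> together with its common neighbours with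
  \<open>w'\<close>. Then \<open>w'\<close> is a partner of \<open>w\<close>, and the splitting
  vertex \<open>y\<close> is a partner of the vertex \<open>t\<close> that it misses.\<close>

lemma two_partners:
  assumes "c \<in> V" "d \<in> V" "c \<noteq> d" "\<not> E c d" "card (common_nbrs c d) = q"
  obtains L i j p r where "L \<subseteq> V" "clique L" "card L = Suc q" "i \<noteq> j" "partner L i p" "partner L j r"
proof -
  obtain w w' y t where w: "w \<in> V" "w' \<in> V" "w \<noteq> w'" "\<not> E w w'" "card (common_nbrs w w') = q"
    and y: "y \<in> V" "E y w" "\<not> E y w'" and t: "t \<in> common_nbrs w w'" "y \<noteq> t" "\<not> E y t"
    using common_nbrs_distinguisher[OF assms(1-4) refl assms(5)] assms(5) by metis
  let ?Q = "common_nbrs w w'"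
  have Q: "clique ?Q" using w by (intro clique_common_nbrs)
  have wQ: "w \<notin> ?Q" by (simp add: common_nbrs_def adj_irrefl)
  have yQ: "E y s" if s: "s \<in> ?Q" "s \<noteq> t" for s
  proof -
    have "E t s" using Q t(1) s unfolding clique_def by metis
    \<comment> \<open>A kite with adjacent pair \<open>t\<close>, \<open>s\<close>, nonadjacent pair
      \<open>w\<close>, \<open>w'\<close>, and \<open>y\<close> attached at \<open>w\<close>; as
      \<open>y\<close> misses \<open>t\<close> and \<open>w'\<close>, it must see
      \<open>s\<close>.\<close>
    then have "E w y \<Longrightarrow> E t y \<or> E s y \<or> E w' y"
      using kite_free[of t s w w' y] s t w y by (auto simp: common_nbrs_def)
    then show ?thesis using y t(3) by (meson adj_sym)
  qed
  show thesis
  proof (rule that[of "insert w ?Q" w t w' y])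
    show "card (insert w ?Q) = Suc q"
      using wQ w(5) by simp
    show "clique (insert w ?Q)"
      using Q adj_sym unfolding clique_def common_nbrs_def by blast
    show "partner (insert w ?Q) w w'"
      using w(1-4) adj_sym adj_irrefl unfolding partner_def common_nbrs_def by blast
    show "partner (insert w ?Q) t y"
      using t y yQ wQ w by (auto simp: partner_def common_nbrs_def adj_irrefl)
  qed (use w t wQ in \<open>auto simp: common_nbrs_def\<close>)
qed

end

text \<open>The size is chosen so that \<open>L\<close> without one vertex has exactly
  \<open>q\<close> elements. Maximality under inclusion is not meant: further vertices may be
  adjacent to all of \<open>L\<close>.\<close>

locale max_clique = max_common_nbrs +
  fixes L
  assumes L_subset: "L \<subseteq> V" and clique_L: "clique L" and card_L: "card L = Suc q"
begin

lemma finite_L: "finite L"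
  using L_subset finite_V by (rule finite_subset)

lemma adj_L: "a \<in> L \<Longrightarrow> b \<in> L \<Longrightarrow> a \<noteq> b \<Longrightarrow> E a b"
  using clique_L by (auto simp: clique_def)

text \<open>\<open>L - {i}\<close> already supplies \<open>q\<close> common neighbours of the
  nonadjacent \<open>i\<close> and \<open>p\<close>, and \<open>q\<close> is the maximum.\<close>

lemma partner_common_nbrs:
  assumes "partner L i p"
  shows "common_nbrs i p = L - {i}"
proof -
  have "L - {i} \<subseteq> common_nbrs i p"
    using assms L_subset adj_L by (auto simp: partner_def common_nbrs_def intro: adj_sym)
  moreover have "card (common_nbrs i p) \<le> card (L - {i})"
    using card_common_nbrs[of i p] assms card_L L_subset finite_L
    by (auto simp: partner_def intro: adj_sym)
  ultimately show ?thesis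
    using card_seteq[of "common_nbrs i p" "L - {i}"] by simp
qed

lemma partner_adj:
  assumes "partner L i p" "x \<in> V" "E x i" "E x p"
  shows "x \<in> L - {i}"
  using partner_common_nbrs[OF assms(1)] assms(2-4) by (auto simp: common_nbrs_def)

text \<open>The partner \<open>r\<close> of \<open>j\<close> sees \<open>i\<close>; if it also saw
  \<open>p\<close>, then \<open>partner_adj\<close> would put it into \<open>L\<close>.\<close>

lemma partners_nonadj:
  assumes "partner L i p" "partner L j r" "i \<noteq> j"
  shows "p \<noteq> r" "\<not> E p r"
proof -
  show "p \<noteq> r" using assms by (auto simp: partner_def)
  show "\<not> E p r"
  proof
    assume "E p r"
    then have "E r p" by (rule adj_sym)
    with partner_adj[OF assms(1), of r] assms show False by (auto simp: partner_def)
  qed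
qed

text \<open>The vertices \<open>a\<close>, \<open>b\<close>, \<open>i\<close>, \<open>p\<close> form
  a diamond, and \<open>x\<close> is attached at one of its nonadjacent vertices \<open>i\<close>,
  \<open>p\<close>. Thus \<open>x\<close> misses at most one vertex of
  \<open>L - {i}\<close>.\<close>

lemma adj_one_end:
  assumes "partner L i p" "x \<in> V" "E x i \<noteq> E x p" "x \<noteq> i"
    and "a \<in> L - {i}" "b \<in> L - {i}" "a \<noteq> b"
  shows "E x a \<or> E x b"
proof -
  have E: "E a b" "E a i" "E a p" "E b i" "E b p" "i \<noteq> p" "\<not> E i p" "\<not> E p i"
    using assms adj_L by (auto simp: partner_def intro: adj_sym)
  have V: "{a, b, i, p, x} \<subseteq> V" "{a, b, p, i, x} \<subseteq> V"
    using assms L_subset by (auto simp: partner_def)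
  show ?thesis
    using kite_free[OF V(1)] kite_free[OF V(2)] E assms(3) by (metis adj_sym)
qed

text \<open>
  With \<open>T = L - {i, j}\<close>, the path \<open>r, i, j, p\<close> lies in a component \<open>C\<close> of the common neighbourhood of
  \<open>T\<close>. As \<open>C\<close> is no module, some \<open>s\<close> outside has a neighbour in \<open>C\<close> but misses some \<open>t \<in> T\<close>. The
  neighbours of \<open>s\<close> in \<open>C\<close> form a clique that spreads along induced paths \<open>a, b, c\<close>, by the kite
  \<open>t, b, a, c, s\<close>; hence it contains \<open>i\<close> and \<open>j\<close>, and \<open>s\<close> is a partner of \<open>t\<close>.
\<close>

lemma third_partner:
  assumes p: "partner L i p" and r: "partner L j r" and "i \<noteq> j"
  obtains t s where "partner L t s" "t \<noteq> i" "t \<noteq> j"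
proof -
  define T where "T = L - {i, j}"
  define W where "W = {v \<in> V. \<forall>t\<in>T. E v t}"
  define R where "R = {(a, b). a \<in> W \<and> b \<in> W \<and> E a b}"
  define C where "C = {v. (i, v) \<in> R\<^sup>*}"
  have ij: "i \<in> L" "j \<in> L" "p \<in> V" "r \<in> V" "p \<notin> L" "r \<notin> L" using p r by (auto simp: partner_def)
  have path: "E r i" "E i j" "E j p" "\<not> E r j" "\<not> E i p" "\<not> E r p"
    using p r ij \<open>i \<noteq> j\<close> partners_nonadj(2)[OF r p] by (auto simp: partner_def intro: adj_L adj_sym)
  \<comment> \<open>As \<open>q\<close> is at least 2, \<open>T\<close> is nonempty; its members lie
    outside \<open>C\<close>, so \<open>C\<close> is not all of \<open>V\<close>.\<close>
  have "card T = q - 1"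
    using ij \<open>i \<noteq> j\<close> finite_L card_L by (simp add: T_def card_Diff_subset)
  then obtain t0 where t0: "t0 \<in> T" using q_ge_2 by fastforce
  have W: "i \<in> W" "j \<in> W" "p \<in> W" "r \<in> W"
    using p r ij L_subset by (auto simp: W_def T_def partner_def intro: adj_L)
  have CW: "C \<subseteq> W"
    unfolding C_def using W(1) by (auto elim: rtranclE simp: R_def)
  have step: "b \<in> C" if "a \<in> C" "b \<in> W" "E a b" for a b
  proof -
    from that have "(a, b) \<in> R" using CW by (auto simp: R_def)
    with that(1) show ?thesis by (auto simp: C_def)
  qed
  have iC: "i \<in> C" by (simp add: C_def)
  have C4: "j \<in> C" "r \<in> C" "p \<in> C"
    using step[OF iC W(2)] step[OF iC W(4)] step[of j p] W path by (auto intro: adj_sym)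
  have "t0 \<in> V - C"
    using CW t0 L_subset adj_irrefl by (auto simp: W_def T_def)
  with prime_moduleE[OF prime _ iC C4(1) \<open>i \<noteq> j\<close>] CW
  obtain s u v where s: "s \<in> V - C" "u \<in> C" "v \<in> C" "E s u" "\<not> E s v"
    unfolding W_def by blast
  have "s \<notin> W" using step[OF s(2) _ adj_sym[OF s(4)]] s(1) by blast
  then obtain t where t: "t \<in> T" "\<not> E s t" using s(1) by (auto simp: W_def)
  have "s \<notin> T" using s CW by (auto simp: W_def intro: adj_sym)
  with t have "s \<noteq> t" by auto
  have tV: "t \<in> V" "t \<in> L" "t \<noteq> i" "t \<noteq> j" using t L_subset by (auto simp: T_def)
  have Ct: "a \<in> V" "E t a" "E a t" if "a \<in> C" for a
    using that CW t by (auto simp: W_def intro: adj_sym)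
  have S_clique: "E a b" if "a \<in> C" "b \<in> C" "E s a" "E s b" "a \<noteq> b" for a b
    using C4_free[of s a t b] that Ct s(1) tV t(2) \<open>s \<noteq> t\<close> by (auto intro: adj_sym)
  have P3: "E s b" if "a \<in> C" "b \<in> C" "c \<in> C" "E s a" "E a b" "E b c" "\<not> E a c" "a \<noteq> c" for a b c
    using kite_free[of t b a c s] S_clique[of a c] that Ct s(1) t(2) tV by (auto intro: adj_sym)
  have "E s i \<and> E s j"
  proof -
    \<comment> \<open>Walking back inside \<open>C\<close> from the neighbour \<open>u\<close> of
      \<open>s\<close> to \<open>i\<close>, \<open>P3\<close> shows that each vertex met is adjacent
      to \<open>s\<close> or to a neighbour of \<open>s\<close> in \<open>C\<close>.\<close>
    have dom: "i \<in> {v. E s v \<or> (\<exists>a\<in>C. E s a \<and> E a v)}"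
    proof -
      have "(i, u) \<in> R\<^sup>*" using s(2) by (simp add: C_def)
      moreover have "i \<in> C" by fact
      ultimately show ?thesis
      proof (induction rule: converse_rtrancl_induct)
        case base
        then show ?case using s by simp
      next
        case (step y z)
        then have z: "z \<in> C" and yz: "E y z" "E z y" "y \<in> W"
          using \<open>\<And>b a. a \<in> C \<Longrightarrow> b \<in> W \<Longrightarrow> E a b \<Longrightarrow> b \<in> C\<close> by (auto simp: R_def intro: adj_sym)
        with step have "E s z \<or> (\<exists>a\<in>C. E s a \<and> E a z)" by simp
        then show ?case
        proof
          assume "E s z"
          then show ?thesis using z yz by auto
        next
          assume "\<exists>a\<in>C. E s a \<and> E a z"
          then obtain a where "a \<in> C" "E s a" "E a z" by auto
          then show ?thesis using P3[of a z y] z yz step.prems by blast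
        qed
      qed
    qed
    have "E s i \<or> E s j \<or> E s p \<or> E s r"
    proof (rule ccontr)
      \<comment> \<open>Then \<open>a\<close> sees \<open>i\<close>, and by \<open>P3\<close> also
        \<open>j\<close>, \<open>r\<close> and finally \<open>p\<close>. Being adjacent to
        \<open>i\<close> and \<open>p\<close>, it lies in \<open>L\<close>, hence in
        \<open>T\<close>; but \<open>T\<close> is disjoint from \<open>W\<close>.\<close>
      assume none: "\<not> ?thesis"
      with dom obtain a where a: "a \<in> C" "E s a" "E a i" by auto
      have neq: "a \<noteq> j" "a \<noteq> r" "a \<noteq> p" using a(2) none by auto
      have "E a j" using P3[OF a(1) iC C4(1) a(2,3) path(2)] neq none by blast
      moreover have "E a r" using P3[OF a(1) iC C4(2) a(2,3) adj_sym[OF path(1)]] neq none by blast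
      ultimately have "E a p" using P3[OF a(1) C4(1) C4(3) a(2) _ path(3)] neq none by blast
      with partner_adj[OF p, of a] a Ct have "a \<in> L - {i}" by auto
      then have "a \<in> T" using neq by (auto simp: T_def)
      with a(1) CW adj_irrefl show False by (auto simp: W_def)
    qed
    moreover have "E s i" if "E s r"
      using P3[OF C4(2) iC C4(1) that path(1,2,4)] r ij by auto
    moreover have "E s j" if "E s p"
      using P3[OF C4(3,1) iC that adj_sym[OF path(3)] adj_sym[OF path(2)]] path(5) ij
      by (auto intro: adj_sym)
    moreover have "E s j" if "E s i"
      using P3[OF iC C4(1,3) that path(2,3,5)] ij by auto
    moreover have "E s i" if "E s j"
      using P3[OF C4(1) iC C4(2) that adj_sym[OF path(2)] adj_sym[OF path(1)]] path(4) ij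
      by (auto intro: adj_sym)
    ultimately show ?thesis by blast
  qed
  then have si: "E s i" "E s j" by auto
  have "s \<notin> L" using si \<open>s \<notin> T\<close> adj_irrefl by (auto simp: T_def)
  \<comment> \<open>So \<open>s\<close> sees \<open>i\<close> but not \<open>p\<close>, and
    \<open>adj_one_end\<close> applied to \<open>a\<close> and the missed vertex \<open>t\<close>
    yields \<open>E s a\<close>.\<close>
  then have "\<not> E s p" using partner_adj[OF p _ si(1)] s(1) by auto
  then have "E s a" if "a \<in> L - {i}" "a \<noteq> t" for a
    using adj_one_end[OF p, of s a t] that si s(1) t(2) tV adj_irrefl by blast
  then have "partner L t s"
    using si t(2) tV \<open>s \<notin> L\<close> s(1) by (auto simp: partner_def)
  with tV that show thesis by blast
qed

text \<open>
  Consider the vertices of \<open>L\<close> that have a partner, all partners, and the vertices outside \<open>L\<close> that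
  are adjacent to all of \<open>L\<close>. Any other vertex is either in \<open>L\<close>, hence adjacent to all of these, or
  misses two vertices of \<open>L\<close>, and then is adjacent to none of them; so they form a module.
\<close>

lemma spider:
  assumes "partner L i1 p1" "partner L i2 p2" "partner L i3 p3" "distinct [i1, i2, i3]"
  obtains p Z where "V = L \<union> p ` L \<union> Z" "card Z \<le> 1" "inj_on p L" "L \<inter> p ` L = {}"
    "Z \<inter> (L \<union> p ` L) = {}"
    "\<And>i j. i \<in> L \<Longrightarrow> j \<in> L \<Longrightarrow> (E (p i) j \<longleftrightarrow> i \<noteq> j) \<and> \<not> E (p i) (p j)"
    "\<And>i z. i \<in> L \<Longrightarrow> z \<in> Z \<Longrightarrow> E z i \<and> \<not> E z (p i)"
proof -
  define A where "A = {i. \<exists>p. partner L i p}"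
  define P where "P = {p. \<exists>i. partner L i p}"
  define Z where "Z = {z \<in> V - L. \<forall>j\<in>L. E z j}"
  let ?M = "A \<union> P \<union> Z"
  have AL: "A \<subseteq> L" and PL: "P \<subseteq> V - L" and ZL: "Z \<subseteq> V - L"
    by (auto simp: A_def P_def Z_def partner_def)
  have A3: "i1 \<in> A" "i2 \<in> A" "i3 \<in> A" using assms by (auto simp: A_def)
  have two: "\<exists>j k. j \<in> A \<and> k \<in> A \<and> j \<noteq> k \<and> j \<noteq> i \<and> k \<noteq> i" for i
    using A3 assms(4) by (metis distinct_length_2_or_more)
  have ZP: "z \<noteq> p" "\<not> E z p" if "z \<in> Z" "partner L i p" for z p i
    using that partner_adj[OF that(2), of z] by (auto simp: Z_def partner_def)
  have all_covered: "V \<subseteq> L \<union> P \<union> Z \<and> A = L"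
  proof (rule ccontr)
    assume neg: "\<not> ?thesis"
    have sub: "?M \<subseteq> V" using AL PL ZL L_subset by auto
    obtain x where "x \<in> V - ?M"
      using neg AL PL ZL L_subset by blast
    moreover have "i1 \<noteq> i2" using assms(4) by simp
    ultimately obtain o' u v where o: "o' \<in> V - ?M" "u \<in> ?M" "v \<in> ?M" "E o' u" "\<not> E o' v"
      using prime_moduleE[OF prime sub, of i1 i2 x] A3 by blast
    show False
    proof (cases "o' \<in> L")
      case True
      have "E o' v"
        using o(1,3) True AL
        by (auto simp: P_def Z_def A_def partner_def intro: adj_L adj_sym)
      with o(5) show False ..
    next
      case False
      then obtain a where a: "a \<in> L" "\<not> E o' a" using o(1) by (auto simp: Z_def)
      \<comment> \<open>Missing only \<open>a\<close> would make \<open>o'\<close> a partner of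
        \<open>a\<close>, hence a member of \<open>P\<close>.\<close>
      then obtain b where b: "b \<in> L" "\<not> E o' b" "b \<noteq> a"
        using o(1) False by (auto simp: P_def partner_def)
      have oA: "\<not> E o' i" if "partner L i p" for i p
      proof
        assume oi: "E o' i"
        then have "\<not> E o' p" using partner_adj[OF that _ oi] o(1) False by auto
        with adj_one_end[OF that, of o' a b] oi a b o(1) False that show False
          by (auto simp: partner_def)
      qed
      \<comment> \<open>\<open>adj_one_end\<close> calls for two vertices of \<open>A\<close>
        besides \<open>i\<close>; the third partner provides them.\<close>
      have oP: "\<not> E o' p" if pp: "partner L i p" for i p
      proof
        assume "E o' p"
        moreover obtain j k where jk: "j \<in> A" "k \<in> A" "j \<noteq> k" "j \<noteq> i" "k \<noteq> i" using two by metis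
        moreover have "\<not> E o' j" "\<not> E o' k" "\<not> E o' i" using jk oA pp by (auto simp: A_def)
        ultimately show False
          using adj_one_end[OF pp, of o' j k] o(1) False pp AL by (auto simp: partner_def)
      qed
      \<comment> \<open>A kite with adjacent pair \<open>i1\<close>, \<open>i2\<close>, nonadjacent
        pair \<open>z\<close>, \<open>p3\<close>, and \<open>o'\<close> attached at
        \<open>z\<close>.\<close>
      have oZ: "\<not> E o' z" if z: "z \<in> Z" for z
      proof
        assume oz: "E o' z"
        have i12: "i1 \<in> L" "i2 \<in> L" "i1 \<noteq> i2" "i1 \<noteq> i3" "i2 \<noteq> i3" using A3 AL assms(4) by auto
        have "{i1, i2, z, p3, o'} \<subseteq> V"
          using i12 L_subset z o(1) assms(3) by (auto simp: Z_def partner_def)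
        moreover have "E i1 i2" "E i1 z" "E i2 z" "E i1 p3" "E i2 p3"
          using i12 z assms(3) by (auto simp: Z_def partner_def intro: adj_L adj_sym)
        ultimately have "E i1 o' \<or> E i2 o' \<or> E p3 o'"
          using kite_free[of i1 i2 z p3 o'] ZP[OF z assms(3)] adj_sym[OF oz] by blast
        then show False using oA assms(1-3) oP[OF assms(3)] by (meson adj_sym)
      qed
      from o(2,4) oA oP oZ show False by (auto simp: A_def P_def)
    qed
  qed
  then have V: "V = L \<union> P \<union> Z" and AL': "A = L"
    using PL ZL L_subset by auto
  \<comment> \<open>\<open>Z\<close> is a module: vertices of \<open>L\<close> see all of it,
    partners see none of it.\<close>
  have "card Z \<le> 1"
  proof (rule ccontr)
    assume "\<not> card Z \<le> 1"
    then obtain z z' where "z \<in> Z" "z' \<in> Z" "z \<noteq> z'"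
      by (metis One_nat_def card_le_Suc0_iff_eq card.infinite zero_le)
    moreover have "Z \<subseteq> V" "i1 \<in> V - Z" using ZL A3 AL L_subset by auto
    ultimately obtain x u v where x: "x \<in> V - Z" "u \<in> Z" "v \<in> Z" "E x u" "\<not> E x v"
      using prime_moduleE[OF prime] by metis
    show False
    proof (cases "x \<in> L")
      case True
      then show False using x by (auto simp: Z_def intro: adj_sym)
    next
      case False
      then have "x \<in> P" using x V by auto
      then show False using x(2,4) ZP adj_sym unfolding P_def by blast
    qed
  qed
  \<comment> \<open>The partners of a fixed \<open>i\<close> form a module: each vertex of
    \<open>L\<close> sees all or none of them, while \<open>Z\<close> and the partners of other
    vertices see none.\<close>
  have unique: "p = r" if pr: "partner L i p" "partner L i r" for i p r
  proof (rule ccontr)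
    assume "p \<noteq> r"
    let ?B = "{p. partner L i p}"
    have B: "?B \<subseteq> V" "p \<in> ?B" "r \<in> ?B" "i \<in> V - ?B" using pr L_subset by (auto simp: partner_def)
    from prime_moduleE[OF prime B(1-3) \<open>p \<noteq> r\<close> B(4)]
    obtain x u v where x: "x \<in> V - ?B" "u \<in> ?B" "v \<in> ?B" "E x u" "\<not> E x v" .
    show False
    proof (cases "x \<in> L")
      case True
      then show False using x by (auto simp: partner_def intro: adj_sym)
    next
      case False
      then have "x \<in> Z \<or> x \<in> P" using x(1) V by blast
      then have "x \<in> Z \<or> (\<exists>j. partner L j x)" by (simp add: P_def)
      moreover have "\<not> partner L i x" using x(1) by simp
      ultimately show False using x(2,4) ZP(2) partners_nonadj(2) by blast
    qed
  qed
  have "\<forall>i\<in>L. \<exists>p. partner L i p" using AL' by (auto simp: A_def)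
  then obtain p where p: "\<And>i. i \<in> L \<Longrightarrow> partner L i (p i)" by metis
  have P: "P = p ` L"
    using p unique by (auto simp: P_def) (metis imageI partner_def)
  show thesis
  proof (rule that[of p Z])
    show "V = L \<union> p ` L \<union> Z" using V unfolding P .
    show "inj_on p L" using p partners_nonadj(1) by (metis inj_onI)
    show "L \<inter> p ` L = {}" using p by (auto simp: partner_def)
    show "Z \<inter> (L \<union> p ` L) = {}" using p ZP ZL by auto
    show "(E (p i) j \<longleftrightarrow> i \<noteq> j) \<and> \<not> E (p i) (p j)" if "i \<in> L" "j \<in> L" for i j
      using p[OF that(1)] p[OF that(2)] that partners_nonadj(2) adj_irrefl
      by (cases "i = j") (auto simp: partner_def)
    show "E z i \<and> \<not> E z (p i)" if "i \<in> L" "z \<in> Z" for i z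
      using that(2) ZP(2)[OF that(2) p[OF that(1)]] that(1) by (auto simp: Z_def)
  qed fact
qed

end

section \<open>Diamond-free chordal graphs\<close>

text \<open>For symmetric \<open>E\<close> this is disconnectedness of the graph on
  \<open>W\<close>.\<close>

definition separated :: "('a \<Rightarrow> 'a \<Rightarrow> bool) \<Rightarrow> 'a set \<Rightarrow> bool" where
  "separated E W \<longleftrightarrow> (\<exists>A B. A \<noteq> {} \<and> B \<noteq> {} \<and> A \<inter> B = {} \<and> A \<union> B = W \<and> (\<forall>a\<in>A. \<forall>b\<in>B. \<not> E a b))"

text \<open>Take a smallest subset of \<open>W\<close> that contains \<open>s\<close> and is left by
  no edge within \<open>W\<close>; a separation would yield a smaller one.\<close>

lemma component_exists:
  assumes "finite W" "s \<in> W" and sym: "\<And>u v. E u v \<Longrightarrow> E v u"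
  obtains C where "C \<subseteq> W" "s \<in> C" "\<not> separated E C" "\<And>u v. u \<in> C \<Longrightarrow> v \<in> W - C \<Longrightarrow> \<not> E u v"
proof -
  let ?P = "\<lambda>C. C \<subseteq> W \<and> s \<in> C \<and> (\<forall>u\<in>C. \<forall>v\<in>W - C. \<not> E u v)"
  have "?P W" using assms(2) by auto
  from ex_has_least_nat[of ?P, OF this, of card]
  obtain C where C: "?P C" and least: "\<And>D. ?P D \<Longrightarrow> card C \<le> card D" by blast
  have "\<not> separated E C"
  proof
    assume "separated E C"
    then obtain A B where AB: "A \<noteq> {}" "B \<noteq> {}" "A \<inter> B = {}" "A \<union> B = C" "\<forall>a\<in>A. \<forall>b\<in>B. \<not> E a b"
      unfolding separated_def by blast
    have False if D: "D \<noteq> {}" "D' \<noteq> {}" "D \<inter> D' = {}" "D \<union> D' = C" "\<forall>a\<in>D. \<forall>b\<in>D'. \<not> E a b" "s \<in> D"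
      for D D'
    proof -
      have "?P D" using C D by blast
      moreover have "D \<subset> C" using D by blast
      moreover have "finite C" using C assms(1) finite_subset by blast
      ultimately show False using least psubset_card_mono by (meson not_le)
    qed
    from this[of A B] this[of B A] AB C sym show False by blast
  qed
  with C that show thesis by blast
qed

locale diamond_free_chordal_graph = chordal_graph +
  assumes diamond_free: "\<lbrakk> {a, b, c, d} \<subseteq> V; E a b; E a c; E a d; E b c; E b d; c \<noteq> d \<rbrakk> \<Longrightarrow> E c d"
begin

text \<open>Otherwise a shortest walk in \<open>W\<close> between nonadjacent neighbours of
  \<open>x\<close>, closed up through \<open>x\<close>, is an induced cycle of length at least
  four.\<close>

lemma nbrs_adjacent:
  assumes W: "W \<subseteq> V" "x \<in> V - W" "\<not> separated E W"
    and ab: "a \<in> W" "b \<in> W" "E x a" "E x b" "a \<noteq> b"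
  shows "E a b"
proof (rule ccontr)
  assume "\<not> E a b"
  define R where "R = {(u, v). u \<in> W \<and> v \<in> W \<and> E u v}"
  \<comment> \<open>The ends are not fixed to \<open>a\<close> and \<open>b\<close>, so that a walk
    may be cut at an interior neighbour of \<open>x\<close>.\<close>
  define walk where "walk n f \<longleftrightarrow> (\<forall>i\<le>n. f i \<in> W) \<and> (\<forall>i<n. E (f i) (f (Suc i))) \<and>
    E x (f 0) \<and> E x (f n) \<and> f 0 \<noteq> f n \<and> \<not> E (f 0) (f n)" for n :: nat and f
  have "(a, b) \<in> R\<^sup>*"
  proof (rule ccontr)
    assume ab': "(a, b) \<notin> R\<^sup>*"
    let ?A = "{v \<in> W. (a, v) \<in> R\<^sup>*}"
    have "\<not> E u v" if "u \<in> ?A" "v \<in> W - ?A" for u v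
    proof
      assume "E u v"
      with that have "(u, v) \<in> R" by (auto simp: R_def)
      with that show False by (auto intro: rtrancl_into_rtrancl)
    qed
    then have "separated E W"
      unfolding separated_def using ab ab'
      by (intro exI[of _ ?A] exI[of _ "W - ?A"]) auto
    with W(3) show False ..
  qed
  then obtain n f where nf: "f 0 = a" "f n = b" "\<forall>i<n. (f i, f (Suc i)) \<in> R"
    by (metis rtrancl_imp_relpow relpow_fun_conv)
  have "f i \<in> W" if "i \<le> n" for i
    using nf ab that by (cases i) (auto simp: R_def Suc_le_eq)
  then have "walk n f"
    using nf ab \<open>\<not> E a b\<close> by (auto simp: walk_def R_def)
  then have ex: "\<exists>n f. walk n f" by blast
  define n where "n = (LEAST n. \<exists>f. walk n f)"
  obtain f where "walk n f" using LeastI_ex[OF ex] by (auto simp: n_def)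
  have least: "n \<le> m" if "walk m g" for m g
    unfolding n_def using that by (intro Least_le) blast
  have fW: "f i \<in> W" if "i \<le> n" for i using \<open>walk n f\<close> that by (simp add: walk_def)
  have fs: "E (f i) (f (Suc i))" if "i < n" for i using \<open>walk n f\<close> that by (simp add: walk_def)
  have ends: "E x (f 0)" "E x (f n)" "f 0 \<noteq> f n" "\<not> E (f 0) (f n)"
    using \<open>walk n f\<close> by (auto simp: walk_def)
  have nochord: "\<not> E (f i) (f j)" if "Suc i < j" "j \<le> n" for i j
  proof
    assume E: "E (f i) (f j)"
    \<comment> \<open>Jumping from \<open>f i\<close> straight to \<open>f j\<close> saves
      \<open>d\<close> steps.\<close>
    define d where "d = j - Suc i"
    have d: "0 < d" "d + Suc i = j" using that by (auto simp: d_def)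
    let ?g = "\<lambda>k. if k \<le> i then f k else f (k + d)"
    have "E (?g k) (?g (Suc k))" if "k < n - d" for k
    proof (cases "k = i")
      case True
      then show ?thesis using E d by (simp add: add.commute)
    next
      case False
      then show ?thesis using fs[of k] fs[of "k + d"] that d \<open>j \<le> n\<close> by auto
    qed
    moreover have "?g k \<in> W" if "k \<le> n - d" for k
      using fW[of k] fW[of "k + d"] that d \<open>j \<le> n\<close> by auto
    moreover have "?g (n - d) = f n" using d \<open>j \<le> n\<close> by auto
    ultimately have "walk (n - d) ?g"
      using ends by (auto simp: walk_def)
    from least[OF this] d \<open>j \<le> n\<close> show False by simp
  qed
  \<comment> \<open>If \<open>f i = f j\<close>, the edge from \<open>f j\<close> to its successor
    is a chord at \<open>f i\<close>; for \<open>j = n\<close>, the edge from the predecessor of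
    \<open>f i\<close> ends in \<open>f n\<close> and is a chord.\<close>
  have distinct: "f i \<noteq> f j" if "i < j" "j \<le> n" for i j
  proof
    assume eq: "f i = f j"
    show False
    proof (cases "j = n")
      case True
      with eq ends(3) have "i \<noteq> 0" by metis
      then obtain m where "i = Suc m" by (cases i) auto
      then show False using nochord[of m n] fs[of m] that eq True by auto
    next
      case False
      then show False using nochord[of i "Suc j"] fs[of j] that eq by auto
    qed
  qed
  have "n \<ge> 2"
  proof -
    have "n \<noteq> 0" using ends(3) by metis
    moreover have "n \<noteq> 1" using ends(4) fs[of 0] by auto
    ultimately show ?thesis by simp
  qed
  \<comment> \<open>Cutting at \<open>f i\<close> gives a shorter walk unless \<open>f i\<close>
    comes right after the start and right before the end. Then \<open>n = 2\<close>, and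
    \<open>x\<close>, \<open>f 1\<close>, \<open>f 0\<close>, \<open>f 2\<close> form a
    diamond.\<close>
  have interior: "\<not> E x (f i)" if "0 < i" "i < n" for i
  proof
    assume xi: "E x (f i)"
    have "i = 1"
    proof (rule ccontr)
      assume "i \<noteq> 1"
      then have "walk i f"
        using that xi ends nochord[of 0 i] distinct[of 0 i] fW fs by (auto simp: walk_def)
      from least[OF this] that show False by simp
    qed
    have "n = Suc i"
    proof (rule ccontr)
      assume "n \<noteq> Suc i"
      then have "walk (n - i) (\<lambda>k. f (k + i))"
        using that xi ends nochord[of i n] distinct[of i n] fW fs by (auto simp: walk_def)
      from least[OF this] that show False by simp
    qed
    with \<open>i = 1\<close> have "E x (f 1)" "E x (f 0)" "E x (f 2)" "E (f 1) (f 0)" "E (f 1) (f 2)"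
      "f 0 \<noteq> f 2" "{x, f 1, f 0, f 2} \<subseteq> V" "\<not> E (f 0) (f 2)"
      using xi ends fs[of 0] fs[of 1] fW W by (auto simp: numeral_2_eq_2 intro: adj_sym)
    then show False using diamond_free[of x "f 1" "f 0" "f 2"] by blast
  qed
  \<comment> \<open>The vertex \<open>x\<close> takes the last position, \<open>n + 1\<close>, of
    the cycle.\<close>
  let ?g = "\<lambda>k. if k \<le> n then f k else x"
  have xf: "x \<noteq> f i" if "i \<le> n" for i using fW[OF that] W by auto
  show False
  proof (rule no_induced_cycle[of "n + 2" ?g])
    show "4 \<le> n + 2" using \<open>n \<ge> 2\<close> by simp
    show "inj_on ?g {..<n + 2}"
    proof (rule inj_onI)
      fix k l assume "k \<in> {..<n + 2}" "l \<in> {..<n + 2}" "?g k = ?g l"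
      then show "k = l"
        using xf[of k] xf[of l] distinct[of k l] distinct[of l k]
        by (cases k l rule: linorder_cases) (auto split: if_splits)
    qed
    show "?g ` {..<n + 2} \<subseteq> V" using fW W by auto
    fix k l assume kl: "k < n + 2" "l < n + 2"
    have sc: "Suc i mod (n + 2) = (if i \<le> n then Suc i else 0)" if "i < n + 2" for i
      using that by (cases "i = Suc n") auto
    have ff: "E (f k) (f l) \<longleftrightarrow> l = Suc k \<or> k = Suc l" if "k \<le> n" "l \<le> n"
    proof (cases k l rule: linorder_cases)
      case less
      then show ?thesis using nochord[of k l] fs[of k] that by (cases "l = Suc k") auto
    next
      case equal
      then show ?thesis by (simp add: adj_irrefl)
    next
      case greater
      then show ?thesis using nochord[of l k] fs[of l] that
        by (cases "k = Suc l") (auto intro: adj_sym dest: adj_sym)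
    qed
    have xfi: "E x (f i) \<longleftrightarrow> i = 0 \<or> i = n" if "i \<le> n" for i
      using interior[of i] ends(1,2) that by (cases "i = 0"; cases "i = n") auto
    have fxi: "E (f i) x \<longleftrightarrow> i = 0 \<or> i = n" if "i \<le> n" for i
      using xfi[OF that] adj_sym by blast
    show "E (?g k) (?g l) \<longleftrightarrow> l = Suc k mod (n + 2) \<or> k = Suc l mod (n + 2)"
      unfolding sc[OF kl(1)] sc[OF kl(2)]
      using kl ff xfi[of l] fxi[of k] adj_irrefl[of x] by auto
  qed
qed

text \<open>Label 3 marks the root, 1 its neighbours, 2 the rest; after the join, 1 is merged into
  2. Empty \<open>W\<close> is treated apart, as the graph without vertices cannot be built.\<close>

lemma constructible_insert_root:
  assumes "3 \<le> k" "W \<subseteq> V" "y \<in> V - W"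
    and "W \<noteq> {} \<Longrightarrow> constructible k E W (\<lambda>v. if E y v then 1 else 2)"
  shows "constructible k E (insert y W) (\<lambda>v. if v = y then 3 else 2)"
proof (cases "W = {}")
  case True
  then show ?thesis using assms(1) adj_irrefl by (auto intro!: constructible_singleton)
next
  case False
  have "constructible k E {y} (\<lambda>v. 3)"
    using assms(1) adj_irrefl by (auto intro!: constructible_singleton)
  then have "constructible k E (W \<union> {y}) (\<lambda>v. if v \<in> W then if E y v then 1 else 2 else 3)"
    using assms adj_sym by (intro constructible_union_join[where J = "{(1, 3)}"] assms(4)[OF False]) auto
  from constructible_relabel[OF this, of 1 2] assms(1) have
    "constructible k E (W \<union> {y}) (\<lambda>v. if (if v \<in> W then if E y v then 1 else 2 else 3) = (1::nat) then 2
      else (if v \<in> W then if E y v then 1 else 2 else 3))"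
    by simp
  then show ?thesis
    by (rule constructible_cong) (use assms(3) in auto)
qed

text \<open>
  For a neighbour \<open>y\<close> of \<open>x\<close> in a connected \<open>W\<close>, the component \<open>C\<close> of \<open>W - {y}\<close> that contains the
  other neighbours of \<open>x\<close> sees \<open>x\<close> and \<open>y\<close> alike. So \<open>C\<close> is built rooted at \<open>x\<close>, the rest of
  \<open>W - {y}\<close> rooted at \<open>y\<close>, and one join connects \<open>y\<close> with \<open>C\<close>.
\<close>

lemma constructible_rooted:
  assumes "3 \<le> k" "W \<subseteq> V" "W \<noteq> {}" "x \<in> V - W"
  shows "constructible k E W (\<lambda>v. if E x v then 1 else 2)"
  using assms(2-)
proof (induction "card W" arbitrary: W x rule: less_induct)
  case less
  have finW: "finite W" using less.prems(1) finite_V by (rule finite_subset)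
  show ?case
  proof (cases "separated E W")
    case True
    then obtain A B where AB: "A \<noteq> {}" "B \<noteq> {}" "A \<inter> B = {}" "A \<union> B = W" "\<forall>a\<in>A. \<forall>b\<in>B. \<not> E a b"
      unfolding separated_def by blast
    then have "A \<subset> W" "B \<subset> W" by auto
    then have "card A < card W" "card B < card W" using finW by (auto intro: psubset_card_mono)
    with less AB have "constructible k E A (\<lambda>v. if E x v then 1 else 2)"
        "constructible k E B (\<lambda>v. if E x v then 1 else 2)"
      by auto
    moreover have "\<not> E u v \<and> \<not> E v u" if "u \<in> A" "v \<in> B" for u v
      using that AB(5) adj_sym by blast
    ultimately have "constructible k E (A \<union> B)
        (\<lambda>v. if v \<in> A then if E x v then 1 else 2 else if E x v then 1 else 2)"
      by (rule constructible_disjoint_union[OF _ _ AB(3)])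
    then show ?thesis
      by (rule constructible_cong) (use AB(4) adj_sym in auto)
  next
    case False
    note clique_nbrs = nbrs_adjacent[OF less.prems(1,3) False]
    \<comment> \<open>If \<open>x\<close> has no neighbour in \<open>W\<close>, any vertex serves as
      \<open>y\<close>.\<close>
    obtain y where y: "y \<in> W" "(\<exists>v\<in>W. E x v) \<Longrightarrow> E x y"
      using less.prems(2) by (metis all_not_in_conv)
    have insert_root: "constructible k E (insert y D) (\<lambda>v. if v = y then 3 else 2)"
      if "D \<subseteq> W - {y}" for D
    proof (rule constructible_insert_root)
      assume "D \<noteq> {}"
      moreover have "card D < card W"
        using that y(1) finW by (intro psubset_card_mono) auto
      ultimately show "constructible k E D (\<lambda>v. if E y v then 1 else 2)"
        using less that y(1) by auto
    qed (use that assms(1) y(1) less.prems(1) in auto)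
    show ?thesis
    proof (cases "\<exists>s\<in>W. s \<noteq> y \<and> E x s")
      case False
      from constructible_relabel[OF insert_root[OF subset_refl], of 3 "if E x y then 1 else 2"] assms(1)
      have "constructible k E (insert y (W - {y})) (\<lambda>v. if (if v = y then 3 else 2) = (3::nat)
          then if E x y then 1 else 2 else (if v = y then 3 else 2))"
        by simp
      then show ?thesis
        by (rule constructible_cong) (use y False in auto)
    next
      case True
      then obtain s where s: "s \<in> W - {y}" "E x s" by auto
      with y have xy: "E x y" by auto
      obtain C where C: "C \<subseteq> W - {y}" "s \<in> C" "\<not> separated E C"
        "\<And>u v. u \<in> C \<Longrightarrow> v \<in> W - {y} - C \<Longrightarrow> \<not> E u v"
        using component_exists[of "W - {y}" s E] finW s adj_sym by blast
      let ?D = "insert y (W - {y} - C)"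
      \<comment> \<open>The neighbours of \<open>x\<close> in \<open>W\<close> are pairwise
        adjacent, so those other than \<open>y\<close> share the component of
        \<open>s\<close>.\<close>
      have nbrs_C: "v \<in> C" if "v \<in> W - {y}" "E x v" for v
      proof (cases "v = s")
        case False
        then have "E s v" using clique_nbrs[of s v] s that by auto
        with C(2,4) that show ?thesis by blast
      qed (simp add: C(2))
      have yC: "E y v \<longleftrightarrow> E x v" if "v \<in> C" for v
      proof
        assume "E x v"
        then show "E y v" using clique_nbrs[of y v] y(1) xy that C(1) by auto
      next
        assume yv: "E y v"
        have ys: "E y s" using clique_nbrs[of y s] y(1) xy s by auto
        show "E x v"
        proof (cases "v = s")
          case False
          \<comment> \<open>Both are neighbours of \<open>y\<close> in the connected
            \<open>C\<close>. With \<open>E s v\<close>, diamond-freeness on \<open>y\<close>,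
            \<open>s\<close>, \<open>x\<close>, \<open>v\<close> forces
            \<open>E x v\<close>.\<close>
          then have "E s v"
            using nbrs_adjacent[of C y s v] C that ys yv y(1) less.prems(1) by auto
          moreover have "x \<noteq> v" "{y, s, x, v} \<subseteq> V"
            using that C(1) less.prems s(1) y(1) by auto
          ultimately show ?thesis
            using diamond_free[of y s x v] ys yv adj_sym[OF xy] adj_sym[OF s(2)] by blast
        qed (simp add: s)
      qed
      have "card C < card W"
        using C(1) y(1) finW by (intro psubset_card_mono) auto
      then have IH: "constructible k E C (\<lambda>v. if E x v then 1 else 2)"
        using less C by auto
      have "constructible k E (C \<union> ?D)
          (\<lambda>v. if v \<in> C then if E x v then 1 else 2 else if v = y then 3 else 2)"
      proof (rule constructible_union_join[OF IH insert_root, where J = "{(1, 3)}"])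
        fix u v assume u: "u \<in> C" and v: "v \<in> ?D"
        have "E u v \<longleftrightarrow> E v u" using adj_sym by blast
        then show "(E u v \<longleftrightarrow> (if E x u then 1 else 2, if v = y then 3 else 2) \<in> {(1::nat, 3::nat)}) \<and>
            (E v u \<longleftrightarrow> (if E x u then 1 else 2, if v = y then 3 else 2) \<in> {(1::nat, 3::nat)})"
          using u v C(4) yC[OF u] by auto
      qed (use C assms(1) in auto)
      \<comment> \<open>As a neighbour of \<open>x\<close>, the vertex \<open>y\<close> ends with
        label 1.\<close>
      from constructible_relabel[OF this, of 3 1] assms(1)
      have "constructible k E (C \<union> ?D) (\<lambda>v. if (if v \<in> C then if E x v then 1 else 2 else
          if v = y then 3 else 2) = (3::nat) then 1 else (if v \<in> C then if E x v then 1 else 2 else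
          if v = y then 3 else 2))"
        by simp
      then show ?thesis
        by (rule constructible_cong) (use C y xy nbrs_C in auto)
    qed
  qed
qed

lemma constructible_diamond_free:
  assumes "3 \<le> k" "V \<noteq> {}"
  shows "\<exists>f. constructible k E V f"
proof -
  obtain y where y: "y \<in> V" using assms(2) by auto
  with constructible_insert_root[OF assms(1), of "V - {y}" y]
    constructible_rooted[OF assms(1), of "V - {y}" y]
  show ?thesis by (auto simp: insert_absorb)
qed

end

section \<open>Clique-width of kite-free chordal graphs\<close>

lemma (in simple_graph) constructible_thick_spider:
  assumes "finite K" "K \<noteq> {}" "K \<subseteq> L" "inj_on p L" "L \<inter> p ` L = {}" "4 \<le> k"
    and K: "\<And>i j. i \<in> L \<Longrightarrow> j \<in> L \<Longrightarrow> i \<noteq> j \<Longrightarrow> E i j"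
    and p: "\<And>i j. i \<in> L \<Longrightarrow> j \<in> L \<Longrightarrow> (E (p i) j \<longleftrightarrow> i \<noteq> j) \<and> \<not> E (p i) (p j)"
  shows "constructible k E (K \<union> p ` K) (\<lambda>v. if v \<in> L then 1 else 2)"
proof -
  have pL: "p i \<notin> L" if "i \<in> L" for i using that assms(5) by auto
  have p': "E i (p j) \<longleftrightarrow> i \<noteq> j" if "i \<in> L" "j \<in> L" for i j
    using p[OF that(2,1)] adj_sym by blast
  have pair: "constructible k E {i, p i} (\<lambda>v. if v \<in> L then a else b)"
    if "i \<in> L" "a \<in> {1..k}" "b \<in> {1..k}" for i a b
  proof -
    have "constructible k E ({i} \<union> {p i}) (\<lambda>v. if v \<in> {i} then a else b)"
      using that p p' pL[OF that(1)] adj_irrefl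
      by (intro constructible_disjoint_union constructible_singleton) auto
    then show ?thesis
      by (rule constructible_cong) (use that pL in auto)
  qed
  show ?thesis
    using assms(1-3)
  proof (induction K rule: finite_ne_induct)
    case (singleton i)
    then show ?case using pair[of i 1 2] assms(6) by (simp add: insert_commute)
  next
    case (insert i F)
    \<comment> \<open>The pairs join the new clique vertex to the old ones and to the old partners,
      and the new partner to the old clique vertices. There is no \<open>(2, 4)\<close>, as partners
      are pairwise nonadjacent.\<close>
    let ?V = "F \<union> p ` F" and ?J = "{(1, 3), (2, 3), (1, 4)} :: (nat \<times> nat) set"
    let ?f = "\<lambda>v. if v \<in> ?V then if v \<in> L then 1 else 2 else if v \<in> L then 3 else (4::nat)"
    have F: "i \<in> L" "F \<subseteq> L" "i \<notin> F" using insert by auto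
    have pneq: "p j \<noteq> p i" if "j \<in> F" for j
      using that F assms(4) by (metis inj_onD subsetD)
    have "i \<notin> p ` F" "p i \<notin> F" "p i \<notin> p ` F"
      using F pL pneq by (blast, blast, metis imageE)
    then have disj: "?V \<inter> {i, p i} = {}"
      using F(3) by (simp add: Int_Un_distrib2 Int_insert_right)
    have "constructible k E (?V \<union> {i, p i}) ?f"
    proof (rule constructible_union_join[where J = ?J])
      show "constructible k E ?V (\<lambda>v. if v \<in> L then 1 else 2)" using insert by simp
      show "constructible k E {i, p i} (\<lambda>v. if v \<in> L then 3 else 4)"
        using F assms(6) by (intro pair) auto
      fix u v assume u: "u \<in> ?V" and v: "v \<in> {i, p i}"
      have uv: "E u v \<longleftrightarrow> E v u" using adj_sym by blast
      have v': "v = i \<or> v = p i" using v by auto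
      from u consider "u \<in> F" | j where "j \<in> F" "u = p j" by auto
      then show "(E u v \<longleftrightarrow> (if u \<in> L then 1 else 2, if v \<in> L then 3 else 4) \<in> ?J) \<and>
          (E v u \<longleftrightarrow> (if u \<in> L then 1 else 2, if v \<in> L then 3 else 4) \<in> ?J)"
      proof cases
        case 1
        then have "u \<in> L" "u \<noteq> i" using F by auto
        then have "E u i" "E u (p i)" using K p' F by auto
        then show ?thesis using v' uv \<open>u \<in> L\<close> F(1) pL by auto
      next
        case 2
        then have "j \<in> L" "j \<noteq> i" using F by auto
        then have "E u i" "\<not> E u (p i)" "u \<notin> L" using p F pL 2 by auto
        then show ?thesis using v' uv F(1) pL by auto
      qed
    qed (use assms(6) disj in auto)
    from constructible_relabel[OF constructible_relabel[OF this, of 3 1], of 4 2] assms(6)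
    have "constructible k E (?V \<union> {i, p i}) (\<lambda>v. if (if ?f v = 3 then 1 else ?f v) = 4 then 2
        else (if ?f v = 3 then 1 else ?f v))"
      by simp
    then show ?case
      by (rule constructible_cong) auto
  qed
qed

lemma (in kite_free_chordal_graph) constructible_prime:
  assumes prime "V \<noteq> {}"
  shows "\<exists>f. constructible 4 E V f"
proof (cases "\<exists>a b c d. {a, b, c, d} \<subseteq> V \<and> E a b \<and> E a c \<and> E a d \<and> E b c \<and> E b d \<and> c \<noteq> d \<and> \<not> E c d")
  case False
  then interpret diamond_free_chordal_graph E V
    by unfold_locales blast
  show ?thesis using constructible_diamond_free[of 4] assms(2) by simp
next
  case True
  then obtain a b c d where diamond: "{a, b, c, d} \<subseteq> V" "E a b" "E a c" "E a d" "E b c" "E b d"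
    "c \<noteq> d" "\<not> E c d" by blast
  define nonadj where "nonadj = (\<lambda>(c, d). c \<in> V \<and> d \<in> V \<and> c \<noteq> d \<and> \<not> E c d)"
  have fin: "finite (common_nbrs c d)" for c d
    by (simp add: common_nbrs_def finite_V)
  have "card (common_nbrs c d) \<le> card V" for c d
    by (rule card_mono[OF finite_V]) (auto simp: common_nbrs_def)
  then have bound: "\<forall>e. nonadj e \<longrightarrow> card (case_prod common_nbrs e) < Suc (card V)"
    by (auto split: prod.split simp: less_Suc_eq_le)
  have cd: "nonadj (c, d)" using diamond by (simp add: nonadj_def)
  from ex_has_greatest_nat[OF cd bound]
  obtain e where e: "nonadj e"
    and max: "\<And>e'. nonadj e' \<Longrightarrow> card (case_prod common_nbrs e') \<le> card (case_prod common_nbrs e)"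
    by blast
  obtain c' d' where e': "e = (c', d')" by (cases e)
  with e have c': "c' \<in> V" "d' \<in> V" "c' \<noteq> d'" "\<not> E c' d'" by (simp_all add: nonadj_def)
  define q where "q = card (common_nbrs c' d')"
  \<comment> \<open>The adjacent pair \<open>a\<close>, \<open>b\<close> of the diamond makes the
    maximum at least two.\<close>
  have "{a, b} \<subseteq> common_nbrs c d" "a \<noteq> b"
    using diamond adj_irrefl by (auto simp: common_nbrs_def)
  then have "2 \<le> card (common_nbrs c d)"
    using card_mono[OF fin, of "{a, b}" c d] by simp
  also have "\<dots> \<le> q" using max[OF cd] e' by (simp add: q_def)
  finally have "2 \<le> q" .
  interpret max_common_nbrs E V q
  proof unfold_locales
    show "card (common_nbrs c d) \<le> q" if "c \<in> V" "d \<in> V" "c \<noteq> d" "\<not> E c d" for c d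
      using max[of "(c, d)"] that e' by (simp add: q_def nonadj_def)
  qed fact+
  obtain L i j p r where L: "L \<subseteq> V" "clique L" "card L = Suc q" "i \<noteq> j" "partner L i p" "partner L j r"
    by (rule two_partners[OF c' q_def[symmetric]])
  interpret max_clique E V q L
    by unfold_locales fact+
  obtain t s where t: "partner L t s" "t \<noteq> i" "t \<noteq> j"
    using third_partner[OF L(5,6,4)] .
  then have "distinct [i, j, t]" using L(4) by simp
  obtain p Z where spider: "V = L \<union> p ` L \<union> Z" "card Z \<le> 1" "inj_on p L" "L \<inter> p ` L = {}"
    "Z \<inter> (L \<union> p ` L) = {}"
    and p: "\<And>i j. i \<in> L \<Longrightarrow> j \<in> L \<Longrightarrow> (E (p i) j \<longleftrightarrow> i \<noteq> j) \<and> \<not> E (p i) (p j)"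
    and Z: "\<And>i z. i \<in> L \<Longrightarrow> z \<in> Z \<Longrightarrow> E z i \<and> \<not> E z (p i)"
    by (rule spider[OF L(5,6) t(1) \<open>distinct [i, j, t]\<close>], rule that) assumption+
  have "L \<noteq> {}" using L(3) by auto
  then have S: "constructible 4 E (L \<union> p ` L) (\<lambda>v. if v \<in> L then 1 else 2)"
    using finite_L spider(3,4) adj_L p by (intro constructible_thick_spider) auto
  have "finite Z" using spider(1) finite_V by (metis finite_Un)
  show ?thesis
  proof (cases "Z = {}")
    case True
    with S spider(1) show ?thesis by (metis Un_empty_right)
  next
    case False
    with spider(2) \<open>finite Z\<close> have "card Z = 1" by (simp add: le_Suc_eq)
    then obtain z where z: "Z = {z}" by (auto simp: card_1_singleton_iff)
    \<comment> \<open>\<open>z\<close> sees exactly the vertices labelled 1, so one join attaches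
      it.\<close>
    have "constructible 4 E {z} (\<lambda>_. 3)"
      by (intro constructible_singleton) (auto simp: adj_irrefl)
    then have "constructible 4 E ((L \<union> p ` L) \<union> {z})
        (\<lambda>v. if v \<in> L \<union> p ` L then if v \<in> L then 1 else 2 else 3)"
    proof (rule constructible_union_join[OF S, where J = "{(1, 3)}"])
      fix u v assume uv: "u \<in> L \<union> p ` L" "v \<in> {z}"
      have "E z u \<longleftrightarrow> u \<in> L"
        using uv(1) Z z spider(4) by auto
      moreover have "E u z \<longleftrightarrow> E z u" using adj_sym by blast
      ultimately show "(E u v \<longleftrightarrow> (if u \<in> L then 1 else 2, 3) \<in> {(1::nat, 3::nat)}) \<and>
          (E v u \<longleftrightarrow> (if u \<in> L then 1 else 2, 3) \<in> {(1::nat, 3::nat)})"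
        using uv by simp
    qed (use spider(5) z in auto)
    moreover have "(L \<union> p ` L) \<union> {z} = V" using spider(1) unfolding z by (rule sym)
    ultimately show ?thesis by auto
  qed
qed

section \<open>Reduction to prime graphs\<close>

lemma kite_free_chordal_graph_mono:
  assumes "kite_free_chordal_graph E V" "W \<subseteq> V"
  shows "kite_free_chordal_graph E W"
proof -
  interpret kite_free_chordal_graph E V by fact
  show ?thesis
  proof
    show "finite W" using assms(2) finite_V by (rule finite_subset)
    show "False" if "4 \<le> r" "inj_on f {..<r}" "f ` {..<r} \<subseteq> W"
      "\<And>i j. \<lbrakk> i < r; j < r \<rbrakk> \<Longrightarrow> E (f i) (f j) \<longleftrightarrow> j = Suc i mod r \<or> i = Suc j mod r" for r f
      using no_induced_cycle[OF that(1,2) order_trans[OF that(3) assms(2)] that(4)] .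
    show "E a e \<or> E b e \<or> E d e" if "{a, b, c, d, e} \<subseteq> W" "E a b" "E a c" "E a d" "E b c" "E b d"
      "E c e" "c \<noteq> d" "\<not> E c d" for a b c d e
      using kite_free[OF order_trans[OF that(1) assms(2)] that(2-)] .
  qed (fact adj_sym, fact adj_irrefl)
qed

text \<open>If the graph is not prime, a nontrivial module and the quotient by it are smaller
  induced subgraphs, hence again kite-free and chordal.\<close>

lemma kite_free_chordal_constructible:
  assumes "kite_free_chordal_graph E V" "V \<noteq> {}"
  shows "\<exists>f. constructible 4 E V f"
  using assms
proof (induction "card V" arbitrary: V rule: less_induct)
  case less
  interpret kite_free_chordal_graph E V by fact
  show ?case
  proof (cases prime)
    case True
    then show ?thesis using less.prems(2) by (rule constructible_prime)
  next
    case False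
    then obtain M where M: "graph_module E V M" "card M > 1" "M \<noteq> V"
      by (auto simp: prime_def not_le)
    have sub: "M \<subset> V" using M by (auto simp: graph_module_def)
    then have fin: "finite M" using finite_V by (auto intro: finite_subset)
    obtain m where m: "m \<in> M" using M(2) by fastforce
    have "card M < card V" using sub finite_V by (rule psubset_card_mono[rotated])
    moreover have "card (insert m (V - M)) < card V"
      using m sub fin finite_V M(2) card_mono[OF finite_V, of M]
      by (simp add: card_Diff_subset less_imp_le)
    moreover have "insert m (V - M) \<subseteq> V" "M \<subseteq> V" using m sub by auto
    ultimately obtain f g where "constructible 4 E M f" "constructible 4 E (insert m (V - M)) g"
      using less.hyps[of M] less.hyps[of "insert m (V - M)"] m
        kite_free_chordal_graph_mono[OF less.prems(1)] by (metis empty_iff insert_not_empty)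
    then show ?thesis using constructible_module[OF adj_sym adj_irrefl M(1) m] by blast
  qed
qed

section \<open>From forbidden induced subgraphs to adjacency conditions\<close>

lemma induced_freeD:
  fixes H :: "'b pair_pre_digraph" and G :: "'a pair_pre_digraph"
  assumes free: "induced_free H G" and G: "pair_graph G" and H: "pair_graph H"
    and inj: "inj_on f (pverts H)" and sub: "f ` pverts H \<subseteq> pverts G"
    and arcs: "\<And>u v. u \<in> pverts H \<Longrightarrow> v \<in> pverts H \<Longrightarrow> (f u, f v) \<in> parcs G \<longleftrightarrow> (u, v) \<in> parcs H"
  shows False
proof -
  interpret G: pair_graph G by fact
  interpret H: pair_graph H by fact
  let ?K = "induced_graph (\<lambda>u v. (u, v) \<in> parcs G) (f ` pverts H)"
  have wf: "pair_wf_digraph ?K"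
    by unfold_locales auto
  interpret K: pair_wf_digraph ?K by (fact wf)
  have "induced_subgraph (with_proj ?K) (with_proj G)"
    unfolding induced_subgraph_def subgraph_def compatible_def
    using sub G.wf_digraph K.wf_digraph
    by (auto simp: arcs_ends_def arc_to_ends_def)
  moreover have "digraph_iso (with_proj ?K) (with_proj H)"
    unfolding digraph_iso_pair_iff[OF wf H.pair_wf_digraph_axioms]
  proof (intro exI conjI)
    show "bij_betw (the_inv_into (pverts H) f) (pverts ?K) (pverts H)"
      using inj by (simp add: bij_betw_the_inv_into inj_on_imp_bij_betw)
    show "\<forall>u\<in>pverts ?K. \<forall>v\<in>pverts ?K. (u, v) \<in> parcs ?K \<longleftrightarrow>
        (the_inv_into (pverts H) f u, the_inv_into (pverts H) f v) \<in> parcs H"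
      using arcs inj by (auto simp: the_inv_into_f_f)
  qed
  ultimately show False using free by (auto simp: induced_free_def)
qed

lemma kite_free_chordal_graph_parcs:
  assumes "pair_graph G" "chordal G" "induced_free (graph_complement chair) G"
  shows "kite_free_chordal_graph (\<lambda>u v. (u, v) \<in> parcs G) (pverts G)"
proof -
  interpret pair_graph G by fact
  show ?thesis
  proof
    show "finite (pverts G)" by simp
    show sym: "(v, u) \<in> parcs G" if "(u, v) \<in> parcs G" for u v
      using that by (rule arcs_symmetric)
    show irrefl: "(v, v) \<notin> parcs G" for v
      using no_loops' by blast
    show False if "4 \<le> r" "inj_on f {..<r}" "f ` {..<r} \<subseteq> pverts G"
      "\<And>i j. \<lbrakk> i < r; j < r \<rbrakk> \<Longrightarrow> (f i, f j) \<in> parcs G \<longleftrightarrow> j = Suc i mod r \<or> i = Suc j mod r" for r f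
    proof (rule induced_freeD[of "cycle_graph r" G f])
      show "induced_free (cycle_graph r) G" using assms(2) that(1) by (simp add: chordal_def)
      show "pair_graph (cycle_graph r)" using that(1) by (intro pair_graph_cycle_graph) simp
    qed (use that assms(1) in \<open>auto simp: cycle_graph_def\<close>)
    show "(a, e) \<in> parcs G \<or> (b, e) \<in> parcs G \<or> (d, e) \<in> parcs G"
      if V: "{a, b, c, d, e} \<subseteq> pverts G" and "(a, b) \<in> parcs G" "(a, c) \<in> parcs G" "(a, d) \<in> parcs G"
        "(b, c) \<in> parcs G" "(b, d) \<in> parcs G" "(c, e) \<in> parcs G" "c \<noteq> d" "(c, d) \<notin> parcs G" for a b c d e
    proof (rule ccontr)
      assume "\<not> ?thesis"
      then have non: "(a, e) \<notin> parcs G" "(b, e) \<notin> parcs G" "(d, e) \<notin> parcs G" "(c, d) \<notin> parcs G"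
        "(e, a) \<notin> parcs G" "(e, b) \<notin> parcs G" "(e, d) \<notin> parcs G" "(d, c) \<notin> parcs G"
        using that(9) sym by blast+
      have adj: "(b, a) \<in> parcs G" "(c, a) \<in> parcs G" "(d, a) \<in> parcs G"
        "(c, b) \<in> parcs G" "(d, b) \<in> parcs G" "(e, c) \<in> parcs G"
        using that(2-7) sym by blast+
      have dist: "distinct [e, a, b, d, c]"
        using that(2-8) non irrefl by auto
      \<comment> \<open>Position \<open>k\<close> is the image of vertex \<open>k\<close> of the
        chair: its centre 0 becomes the pendant vertex \<open>e\<close>, missing \<open>a\<close>,
        \<open>b\<close>, \<open>d\<close>, and its edge between 3 and 4 becomes the nonadjacent
        pair \<open>d\<close>, \<open>c\<close>.\<close>
      let ?f = "(!) [e, a, b, d, c]"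
      have H: "pverts (graph_complement chair) = {0, 1, 2, 3, 4}"
        by (simp add: graph_complement_def chair_def)
      show False
      proof (rule induced_freeD[of "graph_complement chair" G ?f])
        show "pair_graph (graph_complement chair)"
          by (rule pair_graph_complement) (auto simp: chair_def symmetric_def sym_def)
        show "inj_on ?f (pverts (graph_complement chair))"
          unfolding H using dist by (auto simp: inj_on_def)
        show "?f ` pverts (graph_complement chair) \<subseteq> pverts G"
          unfolding H using V by simp
        fix u v assume "u \<in> pverts (graph_complement chair)" "v \<in> pverts (graph_complement chair)"
        then have "u \<in> {0, 1, 2, 3, 4}" "v \<in> {0, 1, 2, 3, 4}" unfolding H by simp_all
        then show "(?f u, ?f v) \<in> parcs G \<longleftrightarrow> (u, v) \<in> parcs (graph_complement chair)"
          by (elim insertE emptyE;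
              simp add: that(2-7) adj non irrefl graph_complement_def chair_def)
      qed fact+
    qed
  qed
qed

theorem theorem6:
  fixes G :: "'a pair_pre_digraph"
  assumes "pair_graph G"
    and "chordal G"
    and "induced_free (graph_complement chair) G"
  shows "clique_width G \<le> 4"
proof (cases "pverts G = {}")
  case True
  then show ?thesis by (simp add: clique_width_def)
next
  case False
  interpret pair_graph G by fact
  obtain l where "cw_construct 4 (induced_graph (\<lambda>u v. (u, v) \<in> parcs G) (pverts G)) l"
    using kite_free_chordal_constructible[OF kite_free_chordal_graph_parcs[OF assms] False]
    by (auto simp: constructible_def)
  moreover have "induced_graph (\<lambda>u v. (u, v) \<in> parcs G) (pverts G) = G"
    by (cases G) (use wellformed' in \<open>auto simp: induced_graph_def\<close>)
  ultimately have "\<exists>l. cw_construct 4 G l" by auto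
  then show ?thesis using False by (auto simp: clique_width_def intro: Least_le)
qed

end
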